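(* For every integer $d\ge1$, let $\Gamma_d\in[0,\infty]$ be the value of the response-history escape game in dimension $d$ and let $$\kappa_d=\exp\left(\int_0^{1/2}\frac{t^{d-1}}{1-t^2}\,dt\right).$$ Then for every $d\ge1$, $$\Gamma_d\ge \kappa_d>1+\frac{1}{d\,2^d}>1,\qquad \Gamma_{d+1}\le\Gamma_d.$$
   Context: $\|\cdot\|$ is the Euclidean norm on $\mathbb{R}^d$. Escape game in dimension $d$. A finite response history of length $n\ge0$ is $H=(x_0,\dots,x_n;r_0,\dots,r_{n-1})$ with all $x_i,r_i\in\mathbb{R}^d$ (no responses if $n=0$). Its state radius is $\operatorname{rad}(H)=\max_{0\le i\le n}\|x_i-x_0\|$. For $u,r\in\mathbb{R}^d$ the successor history is $H^+(u,r)=(x_0,\dots,x_n,u+r;r_0,\dots,r_{n-1},r)$. For $\ell\ge0$, $\operatorname{Env}_\ell(H)=0$ if $n=0$, and $\operatorname{Env}_\ell(H)=\max_{0\le i,j\le n-1}(\|r_i-r_j\|-\ell\|x_i-x_j\|)_+$ if $n\ge1$, where $q_+=\max\{q,0\}$. A play from an initial history $H^0$ is a sequence $\pi=(H^k,u_k,r_k,H^{k+1})_{k\ge0}$ with $u_k,r_k\in\mathbb{R}^d$ and $H^{k+1}=(H^k)^+(u_k,r_k)$. At stage $k$ the controller sees $H^k$ and chooses $u_k$; then the adversary sees $(H^k,u_k)$ and chooses $r_k$. A controller strategy is an arbitrary map $\mu$ from finite response histories to $\mathbb{R}^d$ ($u_k=\mu(H^k)$); an adversary strategy is an arbitrary map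 $\sigma$ from pairs $(H,u)$ to $\mathbb{R}^d$ ($r_k=\sigma(H^k,u_k)$). Let $\operatorname{Env}^\infty_\ell(\pi)=\sup_k\operatorname{Env}_\ell(H^k)$, and let $\operatorname{Esc}_{\ell,H^0}$ be the set of plays $\pi$ from $H^0$ with $\operatorname{Env}^\infty_\ell(\pi)<\infty$ and $\sup_k\operatorname{rad}(H^k)=\infty$. The adversary wins from $H^0$ for $\operatorname{Esc}_{\ell,H^0}$ if there is an adversary strategy $\sigma$ such that for every controller strategy $\mu$ the resulting play lies in $\operatorname{Esc}_{\ell,H^0}$. Let $\mathcal U_\ell$ be the set of finite response histories $H$ (in dimension $d$) from which the adversary wins for $\operatorname{Esc}_{\ell,H}$. The game value is $$\Gamma_d=\sup\bigl(\{0\}\cup\{\ell\ge0\mid\mathcal U_\ell=\varnothing\}\bigr)\in[0,\infty].$$ *)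

theory Defs
  imports "HOL-Analysis.Analysis" "HOL-Library.Function_Algebras"
begin

text \<open>The dimension varies inside a single statement, so \<open>\<real>\<^sup>d\<close> is the set of sequences vanishing from
  index \<open>d\<close> on, with pointwise \<open>+\<close> and \<open>-\<close>.\<close>

type_synonym vec = "nat \<Rightarrow> real"

definition Rd :: "nat \<Rightarrow> vec set" where
  "Rd d = {x. \<forall>i\<ge>d. x i = 0}"

definition enorm :: "nat \<Rightarrow> vec \<Rightarrow> real" where
  "enorm d x = L2_set x {..<d}"

text \<open>A history \<open>(x\<^sub>0,\<dots>,x\<^sub>n; r\<^sub>0,\<dots>,r\<^sub>n\<^sub>-\<^sub>1)\<close> is the pair of its state list and its response list;
  its length \<open>n\<close> is the number of responses.\<close>

type_synonym history = "vec list \<times> vec list"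

definition histories :: "nat \<Rightarrow> history set" where
  "histories d = {(xs, rs). length xs = Suc (length rs) \<and> set xs \<subseteq> Rd d \<and> set rs \<subseteq> Rd d}"

definition rad :: "nat \<Rightarrow> history \<Rightarrow> real" where
  "rad d = (\<lambda>(xs, rs). Max {enorm d (xs ! i - xs ! 0) | i. i \<le> length rs})"

definition succ_hist :: "history \<Rightarrow> vec \<Rightarrow> vec \<Rightarrow> history" where
  "succ_hist = (\<lambda>(xs, rs) u r. (xs @ [u + r], rs @ [r]))"

definition Env :: "nat \<Rightarrow> real \<Rightarrow> history \<Rightarrow> real" where
  "Env d \<l> = (\<lambda>(xs, rs).
     if rs = [] then 0
     else Max {max (enorm d (rs ! i - rs ! j) - \<l> * enorm d (xs ! i - xs ! j)) 0
               | i j. i < length rs \<and> j < length rs})"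

text \<open>Stage \<open>k\<close> of a play is the quadruple \<open>(H\<^sup>k, u\<^sub>k, r\<^sub>k, H\<^sup>k\<^sup>+\<^sup>1)\<close>.\<close>

type_synonym play = "nat \<Rightarrow> history \<times> vec \<times> vec \<times> history"

definition hist_at :: "play \<Rightarrow> nat \<Rightarrow> history" where
  "hist_at \<pi> k = fst (\<pi> k)"

definition plays :: "nat \<Rightarrow> history \<Rightarrow> play set" where
  "plays d H0 = {\<pi>. hist_at \<pi> 0 = H0 \<and>
     (\<forall>k. \<exists>u\<in>Rd d. \<exists>r\<in>Rd d.
        \<pi> k = (hist_at \<pi> k, u, r, hist_at \<pi> (Suc k)) \<and>
        hist_at \<pi> (Suc k) = succ_hist (hist_at \<pi> k) u r)}"

definition Env_inf :: "nat \<Rightarrow> real \<Rightarrow> play \<Rightarrow> ereal" where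
  "Env_inf d \<l> \<pi> = (SUP k. ereal (Env d \<l> (hist_at \<pi> k)))"

definition Esc :: "nat \<Rightarrow> real \<Rightarrow> history \<Rightarrow> play set" where
  "Esc d \<l> H0 = {\<pi> \<in> plays d H0.
     Env_inf d \<l> \<pi> < \<infinity> \<and> (SUP k. ereal (rad d (hist_at \<pi> k))) = \<infinity>}"

definition controller_strategies :: "nat \<Rightarrow> (history \<Rightarrow> vec) set" where
  "controller_strategies d = {\<mu>. \<forall>H\<in>histories d. \<mu> H \<in> Rd d}"

definition adversary_strategies :: "nat \<Rightarrow> (history \<times> vec \<Rightarrow> vec) set" where
  "adversary_strategies d = {\<sigma>. \<forall>H\<in>histories d. \<forall>u\<in>Rd d. \<sigma> (H, u) \<in> Rd d}"

primrec state_seq ::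
    "(history \<Rightarrow> vec) \<Rightarrow> (history \<times> vec \<Rightarrow> vec) \<Rightarrow> history \<Rightarrow> nat \<Rightarrow> history" where
  "state_seq \<mu> \<sigma> H0 0 = H0"
| "state_seq \<mu> \<sigma> H0 (Suc k) =
     (let H = state_seq \<mu> \<sigma> H0 k; u = \<mu> H in succ_hist H u (\<sigma> (H, u)))"

definition resulting_play ::
    "(history \<Rightarrow> vec) \<Rightarrow> (history \<times> vec \<Rightarrow> vec) \<Rightarrow> history \<Rightarrow> play" where
  "resulting_play \<mu> \<sigma> H0 k =
     (let H = state_seq \<mu> \<sigma> H0 k; u = \<mu> H
      in (H, u, \<sigma> (H, u), state_seq \<mu> \<sigma> H0 (Suc k)))"

definition adversary_wins :: "nat \<Rightarrow> real \<Rightarrow> history \<Rightarrow> bool" where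
  "adversary_wins d \<l> H0 \<longleftrightarrow>
     (\<exists>\<sigma>\<in>adversary_strategies d. \<forall>\<mu>\<in>controller_strategies d.
        resulting_play \<mu> \<sigma> H0 \<in> Esc d \<l> H0)"

definition winning_histories :: "nat \<Rightarrow> real \<Rightarrow> history set" where
  "winning_histories d \<l> = {H \<in> histories d. adversary_wins d \<l> H}"

definition game_value :: "nat \<Rightarrow> ereal" where
  "game_value d = Sup ({0} \<union> {ereal \<l> | \<l>. \<l> \<ge> 0 \<and> winning_histories d \<l> = {}})"

definition kappa :: "nat \<Rightarrow> real" where
  "kappa d = exp (integral {0..1/2} (\<lambda>t. t ^ (d - 1) / (1 - t\<^sup>2)))"

end

(* Lower bound. The controller answers a state x_n with u = x_0 - r_i, where x_i is the earlier state
   nearest to x_n, so that x_(n+1) - x_0 = r_n - r_i. If the envelope stays below c, then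
   |x_(n+1) - x_0| <= l dist(x_n, {x_0, ..., x_(n-1)}) + c. Put y_n = x_n - x_0. At every step that
   produces a new maximum M_(n+1) > M_n of |y|, the ball around y_n with radius
   a_n = (M_(n+1) - c) / (2 l) is disjoint from the earlier ones, and 2 a_n <= |y_n|. In the
   scale-invariant measure |y|^(-d) dy, an annulus has measure d omega_d ln(B / A), and a ball B(p, a)
   has measure d omega_d Phi(a / |p|) with Phi(t) = int_0^t s^(d-1) / (1 - s^2) ds, so that
   Phi(1/2) = ln kappa_d and Phi(t) >= ln kappa_d + ln (2 t). Comparing the balls with the annulus that
   contains them, the terms ln (M_(n+1) / M_n) telescope, and every record costs ln kappa_d - ln l > 0
   up to an error that is small for large M: there are boundedly many records, hence no escape.

   The measure of a ball comes from the mean value property of the Poisson kernel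
   P(z) = (q^2 - |z|^2) / |p + z|^d with q = |p|. It is obtained without surface integrals:
   P(x) - P(0) = int_0^1 x . grad P(s x) ds, and -2 x . grad P(s x) / (q^2 - |x|^2) is the divergence
   of W(x) grad P(s x), where W = ln ((q^2 - |x|^2) / (q^2 - a^2)) vanishes on the boundary of the ball. *)

theory Submission
  imports Defs
begin

definition sqn :: "nat \<Rightarrow> vec \<Rightarrow> real" where
  "sqn d x = (\<Sum>i<d. (x i)\<^sup>2)"

abbreviation leb :: "nat \<Rightarrow> vec measure" where
  "leb d \<equiv> Pi\<^sub>M {..<d} (\<lambda>_. lborel)"

lemma enorm_sqn: "enorm d x = sqrt (sqn d x)"
  by (simp add: enorm_def sqn_def L2_set_def)

lemma sqn_nonneg: "0 \<le> sqn d x"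
  by (simp add: sqn_def sum_nonneg)

lemma measurable_sqn [measurable]: "sqn d \<in> borel_measurable (leb d)"
  unfolding sqn_def by measurable

lemma sqn_upd:
  assumes "i < d"
  shows "sqn d (x(i := t)) = t\<^sup>2 + (\<Sum>j\<in>{..<d}-{i}. (x j)\<^sup>2)"
proof -
  have "sqn d (x(i := t)) = ((x(i := t)) i)\<^sup>2 + (\<Sum>j\<in>{..<d}-{i}. ((x(i := t)) j)\<^sup>2)"
    unfolding sqn_def using assms by (subst sum.remove[of _ i]) auto
  also have "(\<Sum>j\<in>{..<d}-{i}. ((x(i := t)) j)\<^sup>2) = (\<Sum>j\<in>{..<d}-{i}. (x j)\<^sup>2)"
    by (intro sum.cong) auto
  finally show ?thesis by (simp only: fun_upd_same)
qed

lemma emeasure_ball0: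
  assumes "r > 0"
  shows "emeasure (leb d) {x \<in> space (leb d). sqn d x \<le> r\<^sup>2} = ennreal (unit_ball_vol d * r ^ d)"
proof -
  have "{x \<in> space (leb d). sqn d x \<le> r\<^sup>2}
    = {f. sqrt (\<Sum>i<d. (f i)\<^sup>2) \<le> r} \<inter> space (leb d)"
    using assms by (auto simp: sqn_def real_sqrt_le_iff' sum_nonneg)
  then show ?thesis using emeasure_cball_aux[of "{..<d}" r] assms by simp
qed

lemma integrable_bounded_ball:
  fixes g :: "vec \<Rightarrow> real"
  assumes [measurable]: "g \<in> borel_measurable (leb d)" and "a > 0"
    and bd: "\<And>x. x \<in> space (leb d) \<Longrightarrow> sqn d x \<le> a\<^sup>2 \<Longrightarrow> \<bar>g x\<bar> \<le> B"
  shows "integrable (leb d) (\<lambda>x. indicator {x \<in> space (leb d). sqn d x \<le> a\<^sup>2} x *\<^sub>R g x)"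
  by (rule integrableI_bounded_set_indicator[where B=B])
     (use bd emeasure_ball0[OF \<open>a > 0\<close>, of d] in auto)

text \<open>Fubini, with the fundamental theorem of calculus on each chord in direction \<open>i\<close>.\<close>
lemma integral_partial_derivative_ball:
  fixes g G :: "vec \<Rightarrow> real"
  assumes [measurable]: "g \<in> borel_measurable (leb d)" and "a > 0" "i < d"
    and bd: "\<And>x. x \<in> space (leb d) \<Longrightarrow> sqn d x \<le> a\<^sup>2 \<Longrightarrow> \<bar>g x\<bar> \<le> B"
    and der: "\<And>x t. sqn d (x(i := t)) \<le> a\<^sup>2 \<Longrightarrow>
      ((\<lambda>t. G (x(i := t))) has_real_derivative g (x(i := t))) (at t)"
    and cont: "\<And>x t. sqn d (x(i := t)) \<le> a\<^sup>2 \<Longrightarrow> isCont (\<lambda>t. g (x(i := t))) t"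
    and bdry: "\<And>x. sqn d x = a\<^sup>2 \<Longrightarrow> G x = 0"
  shows "(\<integral>x. indicator {x \<in> space (leb d). sqn d x \<le> a\<^sup>2} x *\<^sub>R g x \<partial>leb d) = 0"
proof -
  interpret product_sigma_finite "\<lambda>_. lborel :: real measure" by standard
  let ?I = "{..<d} - {i}"
  let ?f = "\<lambda>x. indicator {x \<in> space (leb d). sqn d x \<le> a\<^sup>2} x *\<^sub>R g x"
  have I: "insert i ?I = {..<d}" using \<open>i < d\<close> by auto
  have int: "integrable (leb d) ?f"
    by (rule integrable_bounded_ball) (use assms in auto)
  have "integral\<^sup>L (leb d) ?f = (\<integral>x. (\<integral>t. ?f (x(i := t)) \<partial>lborel) \<partial>Pi\<^sub>M ?I (\<lambda>_. lborel))"
    using product_integral_insert[of ?I i ?f] int by (simp only: I) simp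
  also have "\<dots> = (\<integral>x. 0 \<partial>Pi\<^sub>M ?I (\<lambda>_. lborel :: real measure))"
  proof (rule Bochner_Integration.integral_cong[OF refl])
    fix x assume x: "x \<in> space (Pi\<^sub>M ?I (\<lambda>_. lborel :: real measure))"
    define c where "c = (\<Sum>j\<in>?I. (x j)\<^sup>2)"
    have sq: "sqn d (x(i := t)) = t\<^sup>2 + c" for t
      using sqn_upd[OF \<open>i < d\<close>] by (simp add: c_def)
    have sp: "x(i := t) \<in> space (leb d)" for t
      using x \<open>i < d\<close> by (auto simp: space_PiM PiE_def extensional_def)
    show "(\<integral>t. ?f (x(i := t)) \<partial>lborel) = 0"
    proof (cases "c \<le> a\<^sup>2")
      case False
      then have "?f (x(i := t)) = 0" for t
        using sq[of t] by (auto simp: indicator_def) (smt (verit) zero_le_power2)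
      then show ?thesis by (simp only:) simp
    next
      case True
      define b where "b = sqrt (a\<^sup>2 - c)"
      have b: "b \<ge> 0" "b\<^sup>2 = a\<^sup>2 - c" using True by (auto simp: b_def)
      have iff: "sqn d (x(i := t)) \<le> a\<^sup>2 \<longleftrightarrow> t \<in> {-b..b}" for t
      proof -
        have "sqn d (x(i := t)) \<le> a\<^sup>2 \<longleftrightarrow> t\<^sup>2 \<le> b\<^sup>2" using sq b by auto
        also have "\<dots> \<longleftrightarrow> \<bar>t\<bar> \<le> b" using b(1) by (metis abs_le_square_iff abs_of_nonneg)
        also have "\<dots> \<longleftrightarrow> t \<in> {-b..b}" by auto
        finally show ?thesis .
      qed
      have "(\<integral>t. ?f (x(i := t)) \<partial>lborel) = (\<integral>t. g (x(i := t)) * indicator {-b..b} t \<partial>lborel)"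
        using iff sp by (intro Bochner_Integration.integral_cong) (auto simp: indicator_def)
      also have "\<dots> = G (x(i := b)) - G (x(i := -b))"
      proof (rule integral_FTC_Icc_real[where F = "\<lambda>t. G (x(i := t))"])
        show "- b \<le> b" using b by simp
        fix t assume "- b \<le> t" "t \<le> b"
        then have t: "sqn d (x(i := t)) \<le> a\<^sup>2" using iff[of t] by simp
        show "((\<lambda>t. G (x(i := t))) has_real_derivative g (x(i := t))) (at t)"
          by (rule der[OF t])
        show "isCont (\<lambda>t. g (x(i := t))) t" by (rule cont[OF t])
      qed
      also have "\<dots> = 0" using bdry sq b by simp
      finally show ?thesis .
    qed
  qed
  finally show ?thesis by simp
qed

locale shifted_ball =
  fixes d :: nat and p :: vec and q a :: real
  assumes sqn_p: "sqn d p = q\<^sup>2" and a_pos: "0 < a" and a_less: "a < q"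
begin

definition D :: "real \<Rightarrow> vec \<Rightarrow> real" where
  "D s x = (\<Sum>j<d. (p j + s * x j)\<^sup>2)"

text \<open>\<open>F i s x\<close> and \<open>S i s x\<close> are the first and second partial derivatives, in direction \<open>i\<close> and at
  \<open>s x\<close>, of the Poisson kernel; \<open>g i s\<close> is the \<open>i\<close>-th partial derivative of \<open>W\<cdot>F i s\<close>.\<close>

definition F :: "nat \<Rightarrow> real \<Rightarrow> vec \<Rightarrow> real" where
  "F i s x = - 2 * s * x i * D s x powr (- real d / 2)
     - real d * (q\<^sup>2 - s\<^sup>2 * sqn d x) * (p i + s * x i) * D s x powr (- real d / 2 - 1)"

definition S :: "nat \<Rightarrow> real \<Rightarrow> vec \<Rightarrow> real" where
  "S i s x = - 2 * D s x powr (- real d / 2)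
     + 4 * real d * s * x i * (p i + s * x i) * D s x powr (- real d / 2 - 1)
     - real d * (q\<^sup>2 - s\<^sup>2 * sqn d x) * D s x powr (- real d / 2 - 1)
     + real d * (real d + 2) * (q\<^sup>2 - s\<^sup>2 * sqn d x) * (p i + s * x i)\<^sup>2 * D s x powr (- real d / 2 - 2)"

definition W :: "vec \<Rightarrow> real" where
  "W x = ln (q\<^sup>2 - sqn d x) - ln (q\<^sup>2 - a\<^sup>2)"

definition g :: "nat \<Rightarrow> real \<Rightarrow> vec \<Rightarrow> real" where
  "g i s x = (- 2 * x i / (q\<^sup>2 - sqn d x)) * F i s x + W x * (s * S i s x)"

lemma sqn_less: "sqn d x \<le> a\<^sup>2 \<Longrightarrow> sqn d x < q\<^sup>2"
  using a_pos a_less by (smt (verit) power2_less_imp_less power_mono zero_le_power2 power_strict_mono pos2)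

lemma D_pos:
  assumes "0 \<le> s" "s \<le> 1" "sqn d x \<le> a\<^sup>2"
  shows "0 < D s x"
proof -
  have "q = L2_set p {..<d}"
    using sqn_p a_pos a_less by (simp add: L2_set_def sqn_def)
  also have "\<dots> = L2_set (\<lambda>i. (p i + s * x i) + (- s * x i)) {..<d}" by simp
  also have "\<dots> \<le> L2_set (\<lambda>i. p i + s * x i) {..<d} + L2_set (\<lambda>i. - s * x i) {..<d}"
    by (rule L2_set_triangle_ineq)
  also have "L2_set (\<lambda>i. - s * x i) {..<d} = s * sqrt (sqn d x)"
    using assms by (simp add: L2_set_def sqn_def power_mult_distrib sum_distrib_left[symmetric] real_sqrt_mult)
  also have "s * sqrt (sqn d x) \<le> 1 * a"
    using assms a_pos by (intro mult_mono real_le_lsqrt) (auto simp: sqn_nonneg)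
  finally have "0 < L2_set (\<lambda>i. p i + s * x i) {..<d}" using a_less by simp
  then show ?thesis by (simp add: L2_set_def D_def)
qed

lemma D_upd:
  assumes "i < d"
  shows "D s (x(i := t)) = (p i + s * t)\<^sup>2 + (\<Sum>j\<in>{..<d}-{i}. (p j + s * x j)\<^sup>2)"
proof -
  have "D s (x(i := t)) = (p i + s * (x(i := t)) i)\<^sup>2 + (\<Sum>j\<in>{..<d}-{i}. (p j + s * (x(i := t)) j)\<^sup>2)"
    unfolding D_def using assms by (subst sum.remove[of _ i]) auto
  also have "(\<Sum>j\<in>{..<d}-{i}. (p j + s * (x(i := t)) j)\<^sup>2) = (\<Sum>j\<in>{..<d}-{i}. (p j + s * x j)\<^sup>2)"
    by (intro sum.cong) auto
  finally show ?thesis by (simp only: fun_upd_same)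
qed

text \<open>Harmonicity of the Poisson kernel.\<close>
lemma sum_S_eq_0:
  assumes "0 \<le> s" "s \<le> 1" "sqn d x \<le> a\<^sup>2"
  shows "(\<Sum>i<d. S i s x) = 0"
proof -
  define E where "E = D s x powr (- real d / 2 - 2)"
  have pos: "D s x > 0" using D_pos assms by simp
  have E1: "D s x powr (- real d / 2 - 1) = D s x * E"
  proof -
    have "- real d / 2 - 1 = 1 + (- real d / 2 - 2)" by simp
    then show ?thesis unfolding E_def by (simp only: powr_add) (use pos in simp)
  qed
  have E0: "D s x powr (- real d / 2) = (D s x)\<^sup>2 * E"
    using pos powr_add[of "D s x" 2 "- real d / 2 - 2"] by (simp add: E_def)
  define N where "N = sqn d x"
  define R where "R = (\<Sum>i<d. p i * x i)"
  have DD: "D s x = q\<^sup>2 + 2 * s * R + s\<^sup>2 * N"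
    by (simp add: D_def power2_sum power_mult_distrib sum.distrib sum_distrib_left
        sqn_p[symmetric] sqn_def N_def R_def algebra_simps)
  have X: "(\<Sum>i<d. x i * (p i + s * x i)) = R + s * N"
    by (simp add: sum.distrib sum_distrib_left sqn_def N_def R_def algebra_simps power2_eq_square)
  have "S i s x = - 2 * (D s x)\<^sup>2 * E + (4 * real d * s * D s x * E) * (x i * (p i + s * x i))
     - real d * (q\<^sup>2 - s\<^sup>2 * N) * (D s x * E)
     + (real d * (real d + 2) * (q\<^sup>2 - s\<^sup>2 * N) * E) * (p i + s * x i)\<^sup>2" for i
    unfolding S_def E1 E0 E_def[symmetric] N_def by (simp add: algebra_simps)
  then have "(\<Sum>i<d. S i s x) = real d * (- 2 * (D s x)\<^sup>2 * E) + (4 * real d * s * D s x * E) * (R + s * N)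
     - real d * (real d * (q\<^sup>2 - s\<^sup>2 * N) * (D s x * E))
     + (real d * (real d + 2) * (q\<^sup>2 - s\<^sup>2 * N) * E) * D s x"
    by (simp only: sum.distrib sum_subtractf sum_distrib_left[symmetric] X D_def[symmetric]) simp
  also have "\<dots> = 2 * real d * D s x * E * (- D s x + 2 * s * R + s\<^sup>2 * N + q\<^sup>2)"
    by (simp add: algebra_simps power2_eq_square)
  also have "\<dots> = 0" using DD by simp
  finally show ?thesis .
qed

lemma has_derivative_F_upd:
  assumes "0 \<le> s" "s \<le> 1" "sqn d (x(i := t)) \<le> a\<^sup>2" "i < d"
  shows "((\<lambda>t. F i s (x(i := t))) has_real_derivative s * S i s (x(i := t))) (at t)"
proof -
  define c1 where "c1 = (\<Sum>j\<in>{..<d}-{i}. (p j + s * x j)\<^sup>2)"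
  define c2 where "c2 = (\<Sum>j\<in>{..<d}-{i}. (x j)\<^sup>2)"
  let ?D = "\<lambda>t. (p i + s * t)\<^sup>2 + c1"
  have D: "D s (x(i := t)) = ?D t" for t using D_upd assms by (simp add: c1_def)
  have N: "sqn d (x(i := t)) = t\<^sup>2 + c2" for t using sqn_upd assms by (simp add: c2_def)
  have pos: "?D t > 0" using D_pos[OF assms(1-3)] D by simp
  have dD: "(?D has_real_derivative 2 * s * (p i + s * t)) (at t)"
    by (auto intro!: derivative_eq_intros)
  have dp: "((\<lambda>t. ?D t powr r) has_real_derivative r * ?D t powr (r - 1) * (2 * s * (p i + s * t))) (at t)" for r
    by (rule DERIV_chain2[OF has_real_derivative_powr[OF pos] dD])
  define P where "P k t = ?D t powr (- real d / 2 - k)" for k t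
  have dP: "(P k has_real_derivative (- real d / 2 - k) * P (k + 1) t * (2 * s * (p i + s * t))) (at t)" for k
    using dp[of "- real d / 2 - k"] by (simp add: P_def[abs_def] diff_diff_eq)
  have FP: "F i s (x(i := t)) = - 2 * s * t * P 0 t
     - real d * (q\<^sup>2 - s\<^sup>2 * (t\<^sup>2 + c2)) * (p i + s * t) * P 1 t" for t
    by (simp add: F_def D N P_def)
  have SP: "S i s (x(i := t)) = - 2 * P 0 t + 4 * real d * s * t * (p i + s * t) * P 1 t
     - real d * (q\<^sup>2 - s\<^sup>2 * (t\<^sup>2 + c2)) * P 1 t
     + real d * (real d + 2) * (q\<^sup>2 - s\<^sup>2 * (t\<^sup>2 + c2)) * (p i + s * t)\<^sup>2 * P 2 t"
    by (simp add: S_def D N P_def)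
  show ?thesis
    unfolding FP SP
    apply (rule DERIV_cong)
     apply (rule derivative_eq_intros dP refl)+
    apply (simp add: algebra_simps power2_eq_square)
    done
qed

lemma W_boundary: "sqn d x = a\<^sup>2 \<Longrightarrow> W x = 0"
  by (simp add: W_def)

lemma has_derivative_W_upd:
  assumes "sqn d (x(i := t)) \<le> a\<^sup>2" "i < d"
  shows "((\<lambda>t. W (x(i := t))) has_real_derivative - 2 * t / (q\<^sup>2 - sqn d (x(i := t)))) (at t)"
proof -
  define c2 where "c2 = (\<Sum>j\<in>{..<d}-{i}. (x j)\<^sup>2)"
  have N: "sqn d (x(i := t)) = t\<^sup>2 + c2" for t using sqn_upd assms by (simp add: c2_def)
  have "q\<^sup>2 - (t\<^sup>2 + c2) > 0" using sqn_less[OF assms(1)] N by simp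
  then show ?thesis
    unfolding W_def N by (auto intro!: derivative_eq_intros simp: divide_inverse)
qed

lemma has_derivative_WF_upd:
  assumes "0 \<le> s" "s \<le> 1" "sqn d (x(i := t)) \<le> a\<^sup>2" "i < d"
  shows "((\<lambda>t. W (x(i := t)) * F i s (x(i := t))) has_real_derivative g i s (x(i := t))) (at t)"
  by (rule DERIV_cong[OF DERIV_mult'[OF has_derivative_W_upd has_derivative_F_upd]])
     (use assms in \<open>auto simp: g_def\<close>)

lemma continuous_coord: "continuous_on A (\<lambda>z. snd z i)" for A :: "(real \<times> vec) set"
  by (rule continuous_on_compose2[OF continuous_on_product_coordinates continuous_on_snd[OF continuous_on_id]]) auto

lemma continuous_g:
  assumes "continuous_on A u" "\<And>j. continuous_on A (\<lambda>z. v z j)"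
    "\<And>z. z \<in> A \<Longrightarrow> 0 \<le> u z \<and> u z \<le> 1 \<and> sqn d (v z) \<le> a\<^sup>2"
  shows "continuous_on A (\<lambda>z. g i (u z) (v z))"
proof -
  have D: "continuous_on A (\<lambda>z. D (u z) (v z))"
    unfolding D_def by (intro continuous_intros assms)
  have N: "continuous_on A (\<lambda>z. sqn d (v z))"
    unfolding sqn_def by (intro continuous_intros assms)
  have Dp: "D (u z) (v z) > 0" "q\<^sup>2 - sqn d (v z) > 0" if "z \<in> A" for z
    using D_pos sqn_less assms(3)[OF that] by auto
  have Q: "q\<^sup>2 - a\<^sup>2 > 0" using a_pos a_less by (simp add: power_strict_mono)
  show ?thesis
    unfolding g_def F_def S_def W_def
    using Dp Q by (intro continuous_intros D N assms(1,2)) (auto simp: less_imp_neq[THEN not_sym])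
qed

text \<open>The functions in \<open>space (leb d)\<close> are \<open>undefined\<close> from index \<open>d\<close> on, so that the ball lies in a
  compact set of the product topology.\<close>
lemma bounded_g: "\<exists>B. \<forall>s x. 0 \<le> s \<longrightarrow> s \<le> 1 \<longrightarrow> x \<in> space (leb d) \<longrightarrow> sqn d x \<le> a\<^sup>2 \<longrightarrow> \<bar>g i s x\<bar> \<le> B"
proof -
  let ?C = "PiE UNIV (\<lambda>i. if i < d then {-a..a} else {undefined})"
  let ?K = "({0..1::real} \<times> ?C) \<inter> {z. sqn d (snd z) \<le> a\<^sup>2}"
  have "compact ?C"
    unfolding compactin_euclidean_iff[symmetric] euclidean_product_topology[symmetric]
    by (subst compactin_PiE) (auto simp: compactin_euclidean_iff)
  moreover have "closed {z :: real \<times> vec. sqn d (snd z) \<le> a\<^sup>2}"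
    unfolding sqn_def by (intro closed_Collect_le continuous_intros continuous_coord)
  ultimately have K: "compact ?K" by (intro compact_Int_closed compact_Times) auto
  have "continuous_on ?K (\<lambda>z. g i (fst z) (snd z))"
    by (intro continuous_g continuous_intros continuous_coord) auto
  then have "bounded ((\<lambda>z. g i (fst z) (snd z)) ` ?K)"
    using K by (intro compact_imp_bounded compact_continuous_image)
  then obtain B where B: "\<And>z. z \<in> ?K \<Longrightarrow> \<bar>g i (fst z) (snd z)\<bar> \<le> B"
    unfolding bounded_iff by auto
  have "\<bar>g i s x\<bar> \<le> B" if "0 \<le> s" "s \<le> 1" "x \<in> space (leb d)" "sqn d x \<le> a\<^sup>2" for s x
  proof -
    have "x j \<in> {-a..a}" if "j < d" for j
    proof -
      have "(x j)\<^sup>2 \<le> sqn d x" unfolding sqn_def by (rule member_le_sum) (use that in auto)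
      also note \<open>sqn d x \<le> a\<^sup>2\<close>
      finally show ?thesis using a_pos abs_le_square_iff[of "x j" a] by auto
    qed
    then have "x \<in> ?C" using that by (auto simp: space_PiM PiE_def extensional_def)
    then show ?thesis using B[of "(s, x)"] that by auto
  qed
  then show ?thesis by blast
qed

lemma measurable_D [measurable (raw)]:
  assumes [measurable]: "u \<in> borel_measurable M" "v \<in> M \<rightarrow>\<^sub>M leb d"
  shows "(\<lambda>z. D (u z) (v z)) \<in> borel_measurable M"
  unfolding D_def
proof (intro borel_measurable_sum)
  fix j assume "j \<in> {..<d}"
  then have [measurable]: "(\<lambda>x. x j) \<in> leb d \<rightarrow>\<^sub>M borel"
    using measurable_component_singleton[of j "{..<d}" "\<lambda>_. lborel :: real measure"] by simp
  show "(\<lambda>z. (p j + u z * v z j)\<^sup>2) \<in> borel_measurable M"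
    by measurable
qed

lemma measurable_g [measurable (raw)]:
  assumes [measurable]: "u \<in> borel_measurable M" "v \<in> M \<rightarrow>\<^sub>M leb d" and "i < d"
  shows "(\<lambda>z. g i (u z) (v z)) \<in> borel_measurable M"
proof -
  have [measurable]: "(\<lambda>x. x i) \<in> leb d \<rightarrow>\<^sub>M borel"
    using measurable_component_singleton[of i "{..<d}" "\<lambda>_. lborel :: real measure"] \<open>i < d\<close> by simp
  show ?thesis
    unfolding g_def F_def S_def W_def by measurable
qed

lemma integral_g:
  assumes "0 \<le> s" "s \<le> 1" "i < d"
  shows "(\<integral>x. indicator {x \<in> space (leb d). sqn d x \<le> a\<^sup>2} x *\<^sub>R g i s x \<partial>leb d) = 0"
proof -
  obtain B where B: "\<And>x. x \<in> space (leb d) \<Longrightarrow> sqn d x \<le> a\<^sup>2 \<Longrightarrow> \<bar>g i s x\<bar> \<le> B"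
    using bounded_g[of i] assms by metis
  show ?thesis
  proof (rule integral_partial_derivative_ball[where G = "\<lambda>x. W x * F i s x"])
    fix x t assume x: "sqn d (x(i := t)) \<le> a\<^sup>2"
    show "((\<lambda>t. W (x(i := t)) * F i s (x(i := t))) has_real_derivative g i s (x(i := t))) (at t)"
      by (rule has_derivative_WF_upd) (use assms x in auto)
    have N: "isCont (\<lambda>t. sqn d (x(i := t))) t"
      unfolding sqn_upd[OF \<open>i < d\<close>] by (intro continuous_intros)
    have Dc: "isCont (\<lambda>t. D s (x(i := t))) t"
      unfolding D_upd[OF \<open>i < d\<close>] by (intro continuous_intros)
    have "D s (x(i := t)) > 0" "q\<^sup>2 - sqn d (x(i := t)) > 0"
      using D_pos sqn_less x assms by auto
    moreover have "q\<^sup>2 - a\<^sup>2 > 0" using a_pos a_less by (simp add: power_strict_mono)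
    ultimately show "isCont (\<lambda>t. g i s (x(i := t))) t"
      unfolding g_def F_def S_def W_def fun_upd_same
      by (intro continuous_intros N Dc) auto
  qed (use assms a_pos B W_boundary measurable_g[of "\<lambda>_. s"] in auto)
qed

definition P :: "real \<Rightarrow> vec \<Rightarrow> real" where
  "P s x = (q\<^sup>2 - s\<^sup>2 * sqn d x) * D s x powr (- real d / 2)"

lemma has_derivative_P:
  assumes "0 \<le> s" "s \<le> 1" "sqn d x \<le> a\<^sup>2"
  shows "((\<lambda>s. P s x) has_real_derivative (\<Sum>i<d. x i * F i s x)) (at s)"
proof -
  have pos: "D s x > 0" using D_pos assms by simp
  have dD: "((\<lambda>s. D s x) has_real_derivative 2 * (\<Sum>j<d. x j * (p j + s * x j))) (at s)"
    unfolding D_def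
    by (auto intro!: derivative_eq_intros sum.cong simp: sum_distrib_left algebra_simps)
  have dp: "((\<lambda>s. D s x powr (- real d / 2)) has_real_derivative
     - real d / 2 * D s x powr (- real d / 2 - 1) * (2 * (\<Sum>j<d. x j * (p j + s * x j)))) (at s)"
    by (rule DERIV_chain2[OF has_real_derivative_powr[OF pos] dD])
  have "((\<lambda>s. P s x) has_real_derivative
      - 2 * s * sqn d x * D s x powr (- real d / 2) + (q\<^sup>2 - s\<^sup>2 * sqn d x) *
      (- real d / 2 * D s x powr (- real d / 2 - 1) * (2 * (\<Sum>j<d. x j * (p j + s * x j))))) (at s)"
    unfolding P_def by (rule DERIV_cong, (rule derivative_eq_intros dp refl)+) (simp add: algebra_simps)
  also have "- 2 * s * sqn d x * D s x powr (- real d / 2) + (q\<^sup>2 - s\<^sup>2 * sqn d x) *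
      (- real d / 2 * D s x powr (- real d / 2 - 1) * (2 * (\<Sum>j<d. x j * (p j + s * x j))))
    = (- 2 * s * D s x powr (- real d / 2)) * (\<Sum>j<d. (x j)\<^sup>2)
      - (real d * (q\<^sup>2 - s\<^sup>2 * sqn d x) * D s x powr (- real d / 2 - 1)) * (\<Sum>j<d. x j * (p j + s * x j))"
    by (simp add: sqn_def[symmetric] algebra_simps)
  also have "\<dots> = (\<Sum>i<d. x i * F i s x)"
    unfolding sum_distrib_left sum_subtractf[symmetric] F_def
    by (intro sum.cong refl) (simp add: algebra_simps power2_eq_square)
  finally show ?thesis .
qed

lemma sum_g:
  assumes "0 \<le> s" "s \<le> 1" "sqn d x \<le> a\<^sup>2"
  shows "(\<Sum>i<d. g i s x) = - 2 / (q\<^sup>2 - sqn d x) * (\<Sum>i<d. x i * F i s x)"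
proof -
  have "(\<Sum>i<d. g i s x) = (\<Sum>i<d. - 2 / (q\<^sup>2 - sqn d x) * (x i * F i s x)) + W x * s * (\<Sum>i<d. S i s x)"
    unfolding g_def sum.distrib sum_distrib_left by (simp add: algebra_simps)
  also have "(\<Sum>i<d. S i s x) = 0" by (rule sum_S_eq_0[OF assms])
  finally show ?thesis by (simp add: sum_distrib_left)
qed

lemma integral_sum_g_line:
  assumes "sqn d x \<le> a\<^sup>2"
  shows "(\<integral>s. (\<Sum>i<d. g i s x) * indicator {0..1} s \<partial>lborel) = - 2 / (q\<^sup>2 - sqn d x) * (P 1 x - P 0 x)"
proof -
  have "(\<integral>s. (\<Sum>i<d. g i s x) * indicator {0..1} s \<partial>lborel)
      = (\<integral>s. - 2 / (q\<^sup>2 - sqn d x) * ((\<Sum>i<d. x i * F i s x) * indicator {0..1} s) \<partial>lborel)"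
    using sum_g assms by (intro Bochner_Integration.integral_cong) (auto simp: indicator_def)
  also have "\<dots> = - 2 / (q\<^sup>2 - sqn d x) * (\<integral>s. (\<Sum>i<d. x i * F i s x) * indicator {0..1} s \<partial>lborel)"
    by simp
  also have "(\<integral>s. (\<Sum>i<d. x i * F i s x) * indicator {0..1} s \<partial>lborel) = P 1 x - P 0 x"
  proof (rule integral_FTC_Icc_real)
    fix s :: real assume s: "0 \<le> s" "s \<le> 1"
    show "((\<lambda>s. P s x) has_real_derivative (\<Sum>i<d. x i * F i s x)) (at s)"
      using has_derivative_P s assms by simp
    have "D s x > 0" using D_pos s assms by simp
    moreover have "isCont (\<lambda>s. D s x) s" unfolding D_def by (intro continuous_intros)
    ultimately show "isCont (\<lambda>s. \<Sum>i<d. x i * F i s x) s"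
      unfolding F_def by (intro continuous_intros) auto
  qed simp
  finally show ?thesis .
qed

lemma integrable_pair:
  "integrable (lborel \<Otimes>\<^sub>M leb d)
    (\<lambda>z. indicator ({0..1} \<times> {x \<in> space (leb d). sqn d x \<le> a\<^sup>2}) z *\<^sub>R (\<Sum>i<d. g i (fst z) (snd z)))"
proof -
  interpret ps: product_sigma_finite "\<lambda>_. lborel :: real measure" by standard
  interpret M: sigma_finite_measure "leb d" by (rule ps.sigma_finite) simp
  obtain B where B: "\<And>i s x. 0 \<le> s \<Longrightarrow> s \<le> 1 \<Longrightarrow> x \<in> space (leb d) \<Longrightarrow> sqn d x \<le> a\<^sup>2 \<Longrightarrow> \<bar>g i s x\<bar> \<le> B i"
    using bounded_g by metis
  show ?thesis
  proof (rule integrableI_bounded_set_indicator[where B = "\<Sum>i<d. B i"])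
    show "emeasure (lborel \<Otimes>\<^sub>M leb d) ({0..1::real} \<times> {x \<in> space (leb d). sqn d x \<le> a\<^sup>2}) < \<infinity>"
      using emeasure_ball0[OF a_pos, of d]
      by (subst M.emeasure_pair_measure_Times) (auto simp: ennreal_mult_less_top emeasure_lborel_Icc)
    show "AE z in lborel \<Otimes>\<^sub>M leb d. z \<in> {0..1} \<times> {x \<in> space (leb d). sqn d x \<le> a\<^sup>2} \<longrightarrow>
        norm (\<Sum>i<d. g i (fst z) (snd z)) \<le> (\<Sum>i<d. B i)"
      by (intro AE_I2 impI) (auto intro!: order_trans[OF sum_abs] sum_mono B)
  qed measurable
qed

lemma integral_ball_eq:
  defines "b \<equiv> {x \<in> space (leb d). sqn d x \<le> a\<^sup>2}"
  shows "integrable (leb d) (\<lambda>x. indicator b x *\<^sub>R D 1 x powr (- real d / 2))" (is ?int)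
    and "(\<integral>x. indicator b x *\<^sub>R D 1 x powr (- real d / 2) \<partial>leb d)
      = q\<^sup>2 * q powr (- real d) * (\<integral>x. indicator b x *\<^sub>R (1 / (q\<^sup>2 - sqn d x)) \<partial>leb d)" (is ?eq)
proof -
  interpret ps: product_sigma_finite "\<lambda>_. lborel :: real measure" by standard
  interpret M: sigma_finite_measure "leb d" by (rule ps.sigma_finite) simp
  interpret pair_sigma_finite "lborel :: real measure" "leb d" ..
  let ?h = "\<lambda>s x. indicator ({0..1} \<times> b) (s, x) *\<^sub>R (\<Sum>i<d. g i s x)"
  let ?J = "\<lambda>x. indicator b x *\<^sub>R (1 / (q\<^sup>2 - sqn d x))"
  let ?L = "\<lambda>x. indicator b x *\<^sub>R D 1 x powr (- real d / 2)"
  let ?C = "q\<^sup>2 * q powr (- real d)"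
  have q: "q > 0" using a_pos a_less by simp
  have P0: "P 0 x = ?C" for x
  proof -
    have "D 0 x = q powr 2" using sqn_p q by (simp add: D_def sqn_def)
    then show ?thesis by (simp add: P_def powr_powr)
  qed
  have i: "integrable (lborel \<Otimes>\<^sub>M leb d) (case_prod ?h)"
    using integrable_pair by (simp add: b_def case_prod_beta')
  have gi: "integrable (leb d) (\<lambda>x. indicator b x *\<^sub>R g j s x)" if s: "0 \<le> s" "s \<le> 1" "j < d" for j s
  proof -
    obtain B where "\<And>x. x \<in> space (leb d) \<Longrightarrow> sqn d x \<le> a\<^sup>2 \<Longrightarrow> \<bar>g j s x\<bar> \<le> B"
      using bounded_g[of j] s by metis
    then show ?thesis unfolding b_def by (intro integrable_bounded_ball) (use s a_pos in auto)
  qed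
  have "(\<integral>x. (\<integral>s. ?h s x \<partial>lborel) \<partial>leb d) = (\<integral>s. (\<integral>x. ?h s x \<partial>leb d) \<partial>lborel)"
    by (rule Fubini_integral[OF i])
  also have "\<dots> = (\<integral>s. 0 \<partial>(lborel :: real measure))"
  proof (rule Bochner_Integration.integral_cong[OF refl])
    fix s :: real
    show "(\<integral>x. ?h s x \<partial>leb d) = 0"
    proof (cases "s \<in> {0..1}")
      case True
      have "(\<integral>x. ?h s x \<partial>leb d) = (\<integral>x. (\<Sum>i<d. indicator b x *\<^sub>R g i s x) \<partial>leb d)"
        using True by (intro Bochner_Integration.integral_cong) (auto simp: indicator_def)
      also have "\<dots> = (\<Sum>i<d. \<integral>x. indicator b x *\<^sub>R g i s x \<partial>leb d)"
        by (rule Bochner_Integration.integral_sum) (use gi True in auto)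
      also have "\<dots> = 0" using integral_g True unfolding b_def by (intro sum.neutral) auto
      finally show ?thesis .
    qed (auto simp: indicator_def)
  qed
  finally have z: "(\<integral>x. (\<integral>s. ?h s x \<partial>lborel) \<partial>leb d) = 0" by simp
  have in1: "(\<integral>s. ?h s x \<partial>lborel) = - 2 * (?L x - ?C * ?J x)" for x
  proof (cases "x \<in> b")
    case True
    then have x: "sqn d x \<le> a\<^sup>2" by (simp add: b_def)
    have "(\<integral>s. ?h s x \<partial>lborel) = (\<integral>s. (\<Sum>i<d. g i s x) * indicator {0..1} s \<partial>lborel)"
      using True by (intro Bochner_Integration.integral_cong) (auto simp: indicator_def)
    also have "\<dots> = - 2 * ((P 1 x - P 0 x) / (q\<^sup>2 - sqn d x))"
      unfolding integral_sum_g_line[OF x] by (simp only: times_divide_eq_left times_divide_eq_right)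
    also have "P 1 x = (q\<^sup>2 - sqn d x) * D 1 x powr (- real d / 2)" by (simp add: P_def)
    finally show ?thesis using True P0 sqn_less[OF x] by (simp add: diff_divide_distrib)
  qed simp
  have iJ: "integrable (leb d) ?J"
    unfolding b_def
  proof (rule integrable_bounded_ball[where B = "1 / (q\<^sup>2 - a\<^sup>2)"])
    fix x assume x: "sqn d x \<le> a\<^sup>2"
    have "q\<^sup>2 - a\<^sup>2 > 0" using a_pos a_less by (simp add: power_strict_mono)
    then show "\<bar>1 / (q\<^sup>2 - sqn d x)\<bar> \<le> 1 / (q\<^sup>2 - a\<^sup>2)"
      using x by (auto intro!: divide_left_mono mult_pos_pos)
  qed (use a_pos in auto)
  have "integrable (leb d) (\<lambda>x. - 1 / 2 * (\<integral>s. ?h s x \<partial>lborel))"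
    by (intro integrable_mult_right integrable_snd[OF i])
  moreover have "(\<lambda>x. - 1 / 2 * (\<integral>s. ?h s x \<partial>lborel)) = (\<lambda>x. ?L x - ?C * ?J x)"
    unfolding in1 by (rule ext) (simp only: mult.assoc[symmetric], simp)
  ultimately have iLJ: "integrable (leb d) (\<lambda>x. ?L x - ?C * ?J x)" by (simp only:)
  have "integrable (leb d) (\<lambda>x. (?L x - ?C * ?J x) + ?C * ?J x)"
    by (rule Bochner_Integration.integrable_add[OF iLJ]) (intro integrable_mult_right iJ)
  then show ?int by simp
  have "(\<integral>x. - 2 * (?L x - ?C * ?J x) \<partial>leb d) = 0" using z unfolding in1 .
  then have "(\<integral>x. ?L x - ?C * ?J x \<partial>leb d) = 0" by (simp only: integral_mult_right_zero)
  also have "(\<integral>x. ?L x - ?C * ?J x \<partial>leb d) = (\<integral>x. ?L x \<partial>leb d) - (\<integral>x. ?C * ?J x \<partial>leb d)"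
    by (rule Bochner_Integration.integral_diff[OF \<open>?int\<close>]) (intro integrable_mult_right iJ)
  finally show ?eq by (simp only: integral_mult_right_zero)
qed

end

lemma distr_shift_leb: "distr (leb d) (leb d) (\<lambda>x. \<lambda>i\<in>{..<d}. p i + x i) = leb d"
proof -
  interpret product_sigma_finite "\<lambda>_. lborel :: real measure" by standard
  interpret finite_product_sigma_finite "\<lambda>_. lborel :: real measure" "{..<d}" by standard simp
  have meas: "(\<lambda>x. \<lambda>i\<in>{..<d}. p i + x i) \<in> leb d \<rightarrow>\<^sub>M leb d"
  proof (rule measurable_restrict)
    fix i assume "i \<in> {..<d}"
    then have [measurable]: "(\<lambda>x. x i) \<in> leb d \<rightarrow>\<^sub>M borel"
      using measurable_component_singleton[of i "{..<d}" "\<lambda>_. lborel :: real measure"] by simp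
    show "(\<lambda>x. p i + x i) \<in> leb d \<rightarrow>\<^sub>M lborel" by simp
  qed
  show ?thesis
  proof (rule PiM_eqI)
    fix A :: "nat \<Rightarrow> real set" assume "\<And>i. i \<in> {..<d} \<Longrightarrow> A i \<in> sets lborel"
    then have A: "\<And>i. i \<in> {..<d} \<Longrightarrow> A i \<in> sets borel" by simp
    let ?A = "\<lambda>i. (\<lambda>t. p i + t) -` A i"
    have mA: "?A i \<in> sets borel" if "i \<in> {..<d}" for i
      using measurable_sets[of "\<lambda>t. p i + t" borel borel "A i"] A[OF that] by simp
    have "emeasure (distr (leb d) (leb d) (\<lambda>x. \<lambda>i\<in>{..<d}. p i + x i)) (Pi\<^sub>E {..<d} A)
        = emeasure (leb d) ((\<lambda>x. \<lambda>i\<in>{..<d}. p i + x i) -` (Pi\<^sub>E {..<d} A) \<inter> space (leb d))"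
      using A by (intro emeasure_distr meas sets_PiM_I_finite) auto
    also have "(\<lambda>x. \<lambda>i\<in>{..<d}. p i + x i) -` (Pi\<^sub>E {..<d} A) \<inter> space (leb d) = Pi\<^sub>E {..<d} ?A"
      by (auto simp: space_PiM PiE_def Pi_def extensional_def)
    also have "emeasure (leb d) (Pi\<^sub>E {..<d} ?A) = (\<Prod>i<d. emeasure lborel (?A i))"
      using mA by (intro emeasure_PiM) auto
    also have "\<dots> = (\<Prod>i<d. emeasure lborel (A i))"
    proof (intro prod.cong refl)
      fix i assume i: "i \<in> {..<d}"
      have "emeasure lborel (A i) = emeasure (distr lborel borel ((+) (p i))) (A i)"
        by (simp add: lborel_distr_plus)
      also have "\<dots> = emeasure lborel (?A i)"
        using A[OF i] by (subst emeasure_distr) auto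
      finally show "emeasure lborel (?A i) = emeasure lborel (A i)" by simp
    qed
    finally show "emeasure (distr (leb d) (leb d) (\<lambda>x. \<lambda>i\<in>{..<d}. p i + x i)) (Pi\<^sub>E {..<d} A)
        = (\<Prod>i<d. emeasure lborel (A i))" .
  qed auto
qed

lemma distr_norm_leb:
  assumes "d \<ge> 1"
  shows "distr (leb d) borel (\<lambda>x. sqrt (sqn d x))
    = density lborel (\<lambda>r. ennreal (real d * unit_ball_vol d * r ^ (d - 1)) * indicator {0..} r)" (is "?M = ?N")
proof -
  let ?f = "\<lambda>r. ennreal (real d * unit_ball_vol d * r ^ (d - 1))"
  have M: "emeasure ?M {..r} = (if r > 0 then ennreal (unit_ball_vol d * r ^ d) else 0)" for r
  proof -
    have 1: "emeasure ?M {..s} = emeasure (leb d) {x \<in> space (leb d). sqrt (sqn d x) \<le> s}" for s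
      by (subst emeasure_distr) (auto intro!: arg_cong2[where f=emeasure])
    have 2: "emeasure ?M {..s} = ennreal (unit_ball_vol d * s ^ d)" if "s > 0" for s
    proof -
      have "{x \<in> space (leb d). sqrt (sqn d x) \<le> s} = {x \<in> space (leb d). sqn d x \<le> s\<^sup>2}"
        using that real_sqrt_le_iff'[OF sqn_nonneg] by auto
      then show ?thesis using 1 emeasure_ball0[OF that] by simp
    qed
    show ?thesis
    proof (cases "r > 0")
      case True
      then show ?thesis using 2 by simp
    next
      case False
      have "emeasure ?M {..r} \<le> ennreal (unit_ball_vol d * e)" if "0 < e" "e < 1" for e
      proof -
        have "emeasure ?M {..r} \<le> emeasure ?M {..e}"
          by (rule emeasure_mono) (use False that in auto)
        also have "\<dots> = ennreal (unit_ball_vol d * e ^ d)" using 2 that by simp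
        also have "e ^ d \<le> e ^ 1" using that assms by (intro power_decreasing) auto
        finally show ?thesis by (simp add: ennreal_leI mult_left_mono order_trans)
      qed
      moreover have "((\<lambda>e. ennreal (unit_ball_vol d * e)) \<longlongrightarrow> ennreal (unit_ball_vol d * 0)) (at_right 0)"
        by (intro tendsto_ennrealI tendsto_intros)
      moreover have "\<forall>\<^sub>F e in at_right 0. e \<in> {0<..<1 :: real}"
        by (rule eventually_at_right_real) simp
      ultimately have "emeasure ?M {..r} \<le> ennreal (unit_ball_vol d * 0)"
        by (intro tendsto_lowerbound[of _ _ "at_right 0"]) (auto elim!: eventually_mono)
      then show ?thesis using False by simp
    qed
  qed
  have N: "emeasure ?N {..r} = (if r > 0 then ennreal (unit_ball_vol d * r ^ d) else 0)" for r
  proof -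
    have "emeasure ?N {..r} = (\<integral>\<^sup>+x. ?f x * indicator {0..r} x \<partial>lborel)"
    proof -
      have "emeasure ?N {..r} = (\<integral>\<^sup>+x. ?f x * indicator {0..} x * indicator {..r} x \<partial>lborel)"
        by (rule emeasure_density) simp_all
      then show ?thesis
        by (simp only: mult.assoc indicator_inter_arith[symmetric] Int_atLeastAtMost atLeastAtMost_def)
    qed
    also have "\<dots> = (if r > 0 then ennreal (unit_ball_vol d * r ^ d) else 0)"
    proof (cases "r > 0")
      case True
      have "(\<integral>\<^sup>+x. ?f x * indicator {0..r} x \<partial>lborel) = ennreal (unit_ball_vol d * r ^ d - unit_ball_vol d * 0 ^ d)"
      proof (rule nn_integral_FTC_Icc)
        fix x :: real
        show "((\<lambda>x. unit_ball_vol d * x ^ d) has_real_derivative real d * unit_ball_vol d * x ^ (d - 1)) (at x)"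
          by (auto intro!: derivative_eq_intros)
      qed (use True in auto)
      then show ?thesis using True assms by (simp add: power_0_left)
    next
      case False
      have "{0..r} \<subseteq> {0}" using False by auto
      then have "(\<integral>\<^sup>+x. ?f x * indicator {0..r} x \<partial>lborel) \<le> (\<integral>\<^sup>+x. ?f 0 * indicator {0::real} x \<partial>lborel)"
        by (intro nn_integral_mono) (auto split: split_indicator)
      also have "\<dots> = 0" by (subst nn_integral_cmult_indicator) auto
      finally show ?thesis using False by simp
    qed
    finally show ?thesis .
  qed
  show ?thesis
  proof (rule measure_eqI_generator_eq[where E = "range atMost" and \<Omega> = UNIV and A = "\<lambda>n. {..real n}"])
    show "Int_stable (range (atMost :: real \<Rightarrow> _))"
      by (auto simp: Int_stable_def)
    show "(\<Union>n. {..real n}) = UNIV" by (auto simp: real_arch_simple)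
    show "emeasure ?M {..real n} \<noteq> \<infinity>" for n using M by simp
    have "sets borel = sigma_sets UNIV (range (atMost :: real \<Rightarrow> _))"
      by (subst borel_eq_atMost) simp
    then show "sets ?M = sigma_sets UNIV (range atMost)" "sets ?N = sigma_sets UNIV (range atMost)"
      by simp_all
    show "emeasure ?M X = emeasure ?N X" if "X \<in> range atMost" for X
      using that M N by auto
  qed auto
qed

lemma nn_integral_radial:
  assumes "d \<ge> 1" and [measurable]: "f \<in> borel_measurable borel"
  shows "(\<integral>\<^sup>+x. f (sqrt (sqn d x)) \<partial>leb d)
    = (\<integral>\<^sup>+r. ennreal (real d * unit_ball_vol d * r ^ (d - 1)) * indicator {0..} r * f r \<partial>lborel)"
proof -
  have "(\<integral>\<^sup>+x. f (sqrt (sqn d x)) \<partial>leb d) = (\<integral>\<^sup>+r. f r \<partial>distr (leb d) borel (\<lambda>x. sqrt (sqn d x)))"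
    by (subst nn_integral_distr) auto
  then show ?thesis by (simp add: distr_norm_leb[OF assms(1)] nn_integral_density)
qed

definition lognu :: "nat \<Rightarrow> vec measure" where
  "lognu d = density (leb d) (\<lambda>x. ennreal (sqn d x powr (- real d / 2)))"

lemma emeasure_lognu_annulus:
  assumes "d \<ge> 1" "0 < A" "A \<le> B"
  shows "emeasure (lognu d) {x \<in> space (leb d). A \<le> sqrt (sqn d x) \<and> sqrt (sqn d x) \<le> B}
    = ennreal (real d * unit_ball_vol d * ln (B / A))"
proof -
  let ?w = "real d * unit_ball_vol d"
  have e: "sqn d x powr - (real d / 2) = sqrt (sqn d x) powr (- real d)" for x
    by (subst powr_half_sqrt[symmetric]) (simp_all add: sqn_nonneg powr_powr del: powr_half_sqrt)
  have "emeasure (lognu d) {x \<in> space (leb d). A \<le> sqrt (sqn d x) \<and> sqrt (sqn d x) \<le> B}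
    = (\<integral>\<^sup>+x. (\<lambda>r. ennreal (r powr (- real d)) * indicator {A..B} r) (sqrt (sqn d x)) \<partial>leb d)"
    unfolding lognu_def
    by (subst emeasure_density)
      (auto intro!: nn_integral_cong simp: e indicator_def)
  also have "\<dots> = (\<integral>\<^sup>+r. ennreal (?w / r) * indicator {A..B} r \<partial>lborel)"
  proof (subst nn_integral_radial[OF assms(1)], goal_cases)
    case 2
    have "ennreal (?w * r ^ (d - 1)) * ennreal (r powr - real d) = ennreal (?w / r)" if "r > 0" for r
    proof -
      have "r ^ (d - 1) * r powr - real d = r powr (real (d - 1) - real d)"
        using that by (simp add: powr_diff powr_realpow powr_minus divide_inverse)
      also have "real (d - 1) - real d = - 1" using assms by (simp add: of_nat_diff)
      finally have "r ^ (d - 1) * r powr - real d = 1 / r"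
        using that by (simp add: powr_minus divide_inverse)
      then have "?w * r ^ (d - 1) * r powr - real d = ?w / r" by (simp add: mult.assoc)
      then show ?thesis using that by (simp add: ennreal_mult[symmetric])
    qed
    then show ?case using assms by (intro nn_integral_cong) (auto simp: indicator_def)
  qed simp
  also have "\<dots> = ennreal (?w * ln B - ?w * ln A)"
  proof (rule nn_integral_FTC_Icc)
    fix x assume x: "x \<in> {A..B}"
    show "((\<lambda>x. ?w * ln x) has_real_derivative ?w / x) (at x)"
      using x assms by (auto intro!: derivative_eq_intros)
  qed (use assms in auto)
  also have "?w * ln B - ?w * ln A = ?w * ln (B / A)" using assms by (simp add: ln_div algebra_simps)
  finally show ?thesis .
qed

definition Phi :: "nat \<Rightarrow> real \<Rightarrow> real" where
  "Phi d t = integral {0..t} (\<lambda>s. s ^ (d - 1) / (1 - s\<^sup>2))"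

lemma continuous_Phi_integrand:
  assumes "b < 1"
  shows "continuous_on {0..b} (\<lambda>s. s ^ (d - 1) / (1 - s\<^sup>2) :: real)"
proof -
  have "s\<^sup>2 < 1" if "s \<in> {0..b}" for s :: real
    using that assms by (simp add: power_less_one_iff abs_square_less_1)
  then show ?thesis by (intro continuous_intros) force
qed

lemma ln_kappa: "ln (kappa d) = Phi d (1/2)"
  by (simp add: kappa_def Phi_def)

lemma Phi_lower:
  assumes "d \<ge> 1" "0 < t" "t \<le> 1/2"
  shows "ln (kappa d) + ln (2 * t) \<le> Phi d t"
proof -
  let ?f = "\<lambda>s :: real. s ^ (d - 1) / (1 - s\<^sup>2)"
  have int: "?f integrable_on {0..1/2}"
    by (intro integrable_continuous_real continuous_Phi_integrand) simp
  have "Phi d t + integral {t..1/2} ?f = Phi d (1/2)"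
    unfolding Phi_def by (rule Henstock_Kurzweil_Integration.integral_combine) (use assms int in auto)
  moreover have inv: "((\<lambda>s. 1 / s) has_integral ln (1/2) - ln t) {t..1/2}"
    using assms by (intro fundamental_theorem_of_calculus)
      (auto intro!: derivative_eq_intros simp: has_real_derivative_iff_has_vector_derivative[symmetric])
  have "integral {t..1/2} ?f \<le> ln (1/2) - ln t"
  proof (rule has_integral_le[OF integrable_integral inv])
    show "?f integrable_on {t..1/2}"
      by (rule integrable_on_subinterval[OF int]) (use assms in auto)
    fix s assume s: "s \<in> {t..1/2}"
    then have "s ^ d \<le> s ^ 1" "s\<^sup>2 \<le> (1/2)\<^sup>2"
      using assms by (intro power_decreasing power_mono; simp)+
    then have "s ^ d \<le> 1 - s\<^sup>2" "1 - s\<^sup>2 > 0" using s by (auto simp: power2_eq_square)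
    moreover have "s ^ d = s * s ^ (d - 1)" using assms by (simp flip: power_Suc)
    ultimately show "?f s \<le> 1 / s"
      using s assms by (simp add: field_simps)
  qed
  ultimately show ?thesis
    using assms by (simp add: ln_kappa ln_mult ln_div)
qed

lemma kappa_gt:
  assumes "d \<ge> 1"
  shows "kappa d > 1 + 1 / (real d * 2 ^ d)"
proof -
  have "((\<lambda>s :: real. s ^ (d - 1)) has_integral ((1/2) ^ d / d - 0 ^ d / d)) {0..1/2}"
    using assms by (intro fundamental_theorem_of_calculus)
      (auto intro!: derivative_eq_intros simp: has_real_derivative_iff_has_vector_derivative[symmetric])
  then have "(1/2) ^ d / d - 0 ^ d / d \<le> Phi d (1/2)"
    unfolding Phi_def
  proof (rule has_integral_le[OF _ integrable_integral])
    show "(\<lambda>s. s ^ (d - 1) / (1 - s\<^sup>2) :: real) integrable_on {0..1/2}"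
      by (intro integrable_continuous_real continuous_Phi_integrand) simp
    fix s :: real assume s: "s \<in> {0..1/2}"
    then have "s\<^sup>2 < 1" by (simp add: abs_square_less_1)
    then show "s ^ (d - 1) \<le> s ^ (d - 1) / (1 - s\<^sup>2)"
      using s by (simp add: pos_le_divide_eq mult_left_le)
  qed
  then have *: "1 / (real d * 2 ^ d) \<le> Phi d (1/2)"
    using assms by (simp add: power_divide power_0_left field_simps)
  then have pos: "Phi d (1/2) > 0"
    by (rule less_le_trans[rotated]) (use assms in simp)
  have "1 + Phi d (1/2) < 1 + Phi d (1/2) + (Phi d (1/2))\<^sup>2 / 2" using pos by simp
  also have "\<dots> \<le> exp (Phi d (1/2))" using pos by (intro exp_lower_Taylor_quadratic) simp
  finally show ?thesis using * by (simp add: kappa_def Phi_def)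
qed

context shifted_ball
begin

lemma Phi_has_integral:
  "((\<lambda>r. (q\<^sup>2 * q powr (- real d)) * (r ^ (d - 1) / (q\<^sup>2 - r\<^sup>2))) has_integral Phi d (a / q)) {0..a}"
  if "d \<ge> 1"
proof -
  have q: "q > 0" using a_pos a_less by simp
  let ?f = "\<lambda>s :: real. s ^ (d - 1) / (1 - s\<^sup>2)"
  have "(?f has_integral Phi d (a / q)) (cbox 0 (a / q))"
    unfolding Phi_def cbox_interval
    using a_less q by (intro integrable_integral integrable_continuous_real continuous_Phi_integrand) simp
  from has_integral_affinity[OF this, of "1 / q" 0]
  have "((\<lambda>r. ?f (r / q)) has_integral q * Phi d (a / q)) ((\<lambda>r. q * r) ` {0..a / q})"
    using q by simp
  also have "(\<lambda>r. q * r) ` {0..a / q} = {0..a}"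
    using q a_pos by (simp add: image_mult_atLeastAtMost)
  finally have "((\<lambda>r. 1 / q * ?f (r / q)) has_integral 1 / q * (q * Phi d (a / q))) {0..a}"
    by (rule has_integral_mult_right)
  moreover have "1 / q * ?f (r / q) = (q\<^sup>2 * q powr (- real d)) * (r ^ (d - 1) / (q\<^sup>2 - r\<^sup>2))" for r
  proof -
    have "q ^ d = q * q ^ (d - 1)" using that by (simp flip: power_Suc)
    then have "q powr (- real d) = 1 / (q * q ^ (d - 1))"
      using q by (simp add: powr_minus powr_realpow divide_inverse)
    moreover have "1 - (r / q)\<^sup>2 = (q\<^sup>2 - r\<^sup>2) / q\<^sup>2"
      using q by (simp add: power_divide field_simps)
    moreover have "1 / q * (R / Q / (Z / q\<^sup>2)) = q\<^sup>2 * (1 / (q * Q)) * (R / Z)" for R Q Z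
      using q by (cases "Z = 0"; cases "Q = 0") (simp_all add: field_simps power2_eq_square)
    ultimately show ?thesis by (simp only: power_divide)
  qed
  ultimately show ?thesis using q by simp
qed

lemma emeasure_lognu_ball:
  assumes "d \<ge> 1"
  shows "emeasure (lognu d) {x \<in> space (leb d). sqn d (x - p) \<le> a\<^sup>2}
    = ennreal (real d * unit_ball_vol d * Phi d (a / q))"
proof -
  let ?w = "real d * unit_ball_vol d"
  let ?b = "{x \<in> space (leb d). sqn d x \<le> a\<^sup>2}"
  let ?B = "{x \<in> space (leb d). sqn d (x - p) \<le> a\<^sup>2}"
  let ?sh = "\<lambda>x. \<lambda>i\<in>{..<d}. p i + x i"
  let ?C = "q\<^sup>2 * q powr (- real d)"
  have q: "q > 0" using a_pos a_less by simp
  have coord: "(\<lambda>x. x i) \<in> leb d \<rightarrow>\<^sub>M borel" if "i < d" for i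
    using measurable_component_singleton[of i "{..<d}" "\<lambda>_. lborel :: real measure"] that by simp
  have [measurable]: "?sh \<in> leb d \<rightarrow>\<^sub>M leb d"
    by (rule measurable_restrict) (use coord in auto)
  have [measurable]: "(\<lambda>x. sqn d (x - p)) \<in> borel_measurable (leb d)"
    unfolding sqn_def by (intro borel_measurable_sum borel_measurable_power) (use coord in auto)
  have s1: "sqn d (?sh x) = D 1 x" for x by (simp add: sqn_def D_def)
  have s2: "sqn d (?sh x - p) = sqn d x" for x by (simp add: sqn_def)
  have "emeasure (lognu d) ?B = (\<integral>\<^sup>+x. ennreal (sqn d x powr (- real d / 2)) * indicator ?B x \<partial>leb d)"
    unfolding lognu_def by (rule emeasure_density) measurable
  also have "\<dots> = (\<integral>\<^sup>+x. ennreal (sqn d x powr (- real d / 2)) * indicator ?B x \<partial>distr (leb d) (leb d) ?sh)"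
    by (simp only: distr_shift_leb)
  also have "\<dots> = (\<integral>\<^sup>+x. ennreal (sqn d (?sh x) powr (- real d / 2)) * indicator ?B (?sh x) \<partial>leb d)"
    by (rule nn_integral_distr) measurable
  also have "\<dots> = (\<integral>\<^sup>+x. ennreal (indicator ?b x *\<^sub>R D 1 x powr (- real d / 2)) \<partial>leb d)"
  proof (rule nn_integral_cong)
    fix x assume x: "x \<in> space (leb d)"
    have "?sh x \<in> space (leb d)" by (simp add: space_PiM)
    then have "indicator ?B (?sh x) = (indicator ?b x :: ennreal)"
      using s2[of x] x by (auto simp: indicator_def)
    then show "ennreal (sqn d (?sh x) powr (- real d / 2)) * indicator ?B (?sh x)
        = ennreal (indicator ?b x *\<^sub>R D 1 x powr (- real d / 2))"
      by (simp only: s1) (auto simp: indicator_def)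
  qed
  also have "\<dots> = ennreal (\<integral>x. indicator ?b x *\<^sub>R D 1 x powr (- real d / 2) \<partial>leb d)"
    by (rule nn_integral_eq_integral[OF integral_ball_eq(1)]) simp
  also have "\<dots> = ennreal (\<integral>x. ?C * (indicator ?b x *\<^sub>R (1 / (q\<^sup>2 - sqn d x))) \<partial>leb d)"
    unfolding integral_ball_eq(2) by (simp only: integral_mult_right_zero)
  also have "\<dots> = (\<integral>\<^sup>+x. ennreal (?C * (indicator ?b x *\<^sub>R (1 / (q\<^sup>2 - sqn d x)))) \<partial>leb d)"
  proof (rule nn_integral_eq_integral[symmetric])
    have Q: "q\<^sup>2 - a\<^sup>2 > 0" using a_pos a_less by (simp add: power_strict_mono)
    then have "integrable (leb d) (\<lambda>x. indicator ?b x *\<^sub>R (1 / (q\<^sup>2 - sqn d x)))"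
      using a_pos by (intro integrable_bounded_ball[where B = "1 / (q\<^sup>2 - a\<^sup>2)"])
        (auto intro!: divide_left_mono mult_pos_pos)
    then show "integrable (leb d) (\<lambda>x. ?C * (indicator ?b x *\<^sub>R (1 / (q\<^sup>2 - sqn d x))))"
      by (rule integrable_mult_right)
    show "AE x in leb d. 0 \<le> ?C * (indicator ?b x *\<^sub>R (1 / (q\<^sup>2 - sqn d x)))"
      using sqn_less by (intro AE_I2) (auto simp: indicator_def less_imp_le)
  qed
  also have "\<dots> = (\<integral>\<^sup>+x. (\<lambda>r. ennreal (?C * (indicator {0..a} r *\<^sub>R (1 / (q\<^sup>2 - r\<^sup>2))))) (sqrt (sqn d x)) \<partial>leb d)"
  proof (rule nn_integral_cong)
    fix x assume "x \<in> space (leb d)"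
    moreover have "sqrt (sqn d x) \<le> a \<longleftrightarrow> sqn d x \<le> a\<^sup>2"
      using a_pos by (intro real_sqrt_le_iff' sqn_nonneg) simp
    ultimately show "ennreal (?C * (indicator ?b x *\<^sub>R (1 / (q\<^sup>2 - sqn d x))))
      = (\<lambda>r. ennreal (?C * (indicator {0..a} r *\<^sub>R (1 / (q\<^sup>2 - r\<^sup>2))))) (sqrt (sqn d x))"
      by (auto simp: indicator_def sqn_nonneg)
  qed
  also have "\<dots> = (\<integral>\<^sup>+r. ennreal (?w * r ^ (d - 1)) * indicator {0..} r *
      ennreal (?C * (indicator {0..a} r *\<^sub>R (1 / (q\<^sup>2 - r\<^sup>2)))) \<partial>lborel)"
    by (rule nn_integral_radial[OF assms]) measurable
  also have "\<dots> = (\<integral>\<^sup>+r. ennreal (?w * (?C * (r ^ (d - 1) / (q\<^sup>2 - r\<^sup>2)))) * indicator {0..a} r \<partial>lborel)"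
  proof (rule nn_integral_cong)
    fix r :: real
    show "ennreal (?w * r ^ (d - 1)) * indicator {0..} r * ennreal (?C * (indicator {0..a} r *\<^sub>R (1 / (q\<^sup>2 - r\<^sup>2))))
      = ennreal (?w * (?C * (r ^ (d - 1) / (q\<^sup>2 - r\<^sup>2)))) * indicator {0..a} r"
    proof (cases "r \<in> {0..a}")
      case True
      then have "q\<^sup>2 - r\<^sup>2 > 0" using a_less by (simp add: power_strict_mono)
      then show ?thesis using True by (simp add: ennreal_mult[symmetric] mult_ac)
    qed simp
  qed
  also have "\<dots> = ennreal (?w * Phi d (a / q))"
  proof (rule nn_integral_has_integral_lebesgue')
    show "((\<lambda>r. ?w * (?C * (r ^ (d - 1) / (q\<^sup>2 - r\<^sup>2)))) has_integral ?w * Phi d (a / q)) {0..a}"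
      by (rule has_integral_mult_right[OF Phi_has_integral[OF assms]])
    fix r assume r: "r \<in> {0..a}"
    then have "q\<^sup>2 - r\<^sup>2 > 0" using a_less by (simp add: power_strict_mono)
    then show "0 \<le> ?w * (?C * (r ^ (d - 1) / (q\<^sup>2 - r\<^sup>2)))" using r by simp
  qed
  finally show ?thesis .
qed

end

lemma enorm_triangle: "enorm d (x + y) \<le> enorm d x + enorm d y"
  using L2_set_triangle_ineq[of x y "{..<d}"] by (simp add: enorm_def plus_fun_def)

lemma enorm_uminus: "enorm d (- x) = enorm d x"
  by (simp add: enorm_sqn sqn_def)

lemma enorm_minus_commute: "enorm d (x - y) = enorm d (y - x)"
  by (simp add: enorm_sqn sqn_def power2_commute)

lemma sum_ln_packing:
  assumes d: "d \<ge> 1" and "finite J"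
    and pos: "\<And>j. j \<in> J \<Longrightarrow> 0 < \<alpha> j" and half: "\<And>j. j \<in> J \<Longrightarrow> 2 * \<alpha> j \<le> enorm d (p j)"
    and disj: "\<And>i j. i \<in> J \<Longrightarrow> j \<in> J \<Longrightarrow> i \<noteq> j \<Longrightarrow> \<alpha> i + \<alpha> j < enorm d (p i - p j)"
    and AB: "0 < A" "A \<le> B"
    and lo: "\<And>j. j \<in> J \<Longrightarrow> A \<le> enorm d (p j) - \<alpha> j"
    and hi: "\<And>j. j \<in> J \<Longrightarrow> enorm d (p j) + \<alpha> j \<le> B"
  shows "(\<Sum>j\<in>J. ln (kappa d) + ln (2 * \<alpha> j / enorm d (p j))) \<le> ln (B / A)"
proof -
  let ?w = "real d * unit_ball_vol d"
  let ?b = "\<lambda>j. {x \<in> space (leb d). sqn d (x - p j) \<le> (\<alpha> j)\<^sup>2}"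
  let ?ann = "{x \<in> space (leb d). A \<le> sqrt (sqn d x) \<and> sqrt (sqn d x) \<le> B}"
  have w: "?w > 0" using d by simp
  have bE: "?b j = {x \<in> space (leb d). enorm d (x - p j) \<le> \<alpha> j}" if "j \<in> J" for j
    using real_sqrt_le_iff'[OF sqn_nonneg, of "\<alpha> j"] pos[OF that] by (auto simp: enorm_sqn)
  have sb: "shifted_ball d (p j) (enorm d (p j)) (\<alpha> j)" if "j \<in> J" for j
    using pos[OF that] half[OF that] by unfold_locales (auto simp: enorm_sqn sqn_nonneg)
  have coord: "(\<lambda>x. x i) \<in> leb d \<rightarrow>\<^sub>M borel" if "i < d" for i
    using measurable_component_singleton[of i "{..<d}" "\<lambda>_. lborel :: real measure"] that by simp
  have [measurable]: "(\<lambda>x. sqn d (x - y)) \<in> borel_measurable (leb d)" for y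
    unfolding sqn_def by (intro borel_measurable_sum borel_measurable_power) (use coord in auto)
  have Phi0: "0 \<le> Phi d t" if "0 \<le> t" "t < 1" for t
    unfolding Phi_def
  proof (rule integral_nonneg)
    show "(\<lambda>s. s ^ (d - 1) / (1 - s\<^sup>2)) integrable_on {0..t}"
      by (intro integrable_continuous_real continuous_Phi_integrand that)
    fix s assume s: "s \<in> {0..t}"
    then have "s\<^sup>2 < 1" using that by (simp add: abs_square_less_1)
    then show "0 \<le> s ^ (d - 1) / (1 - s\<^sup>2)" using s by simp
  qed
  have "ennreal (\<Sum>j\<in>J. ?w * Phi d (\<alpha> j / enorm d (p j))) = (\<Sum>j\<in>J. ennreal (?w * Phi d (\<alpha> j / enorm d (p j))))"
  proof (rule sum_ennreal[symmetric])
    fix j assume j: "j \<in> J"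
    then show "0 \<le> ?w * Phi d (\<alpha> j / enorm d (p j))"
      using w pos[OF j] half[OF j] by (intro mult_nonneg_nonneg Phi0) auto
  qed
  also have "\<dots> = (\<Sum>j\<in>J. emeasure (lognu d) (?b j))"
    using shifted_ball.emeasure_lognu_ball[OF sb d] by (intro sum.cong) auto
  also have "\<dots> = emeasure (lognu d) (\<Union>j\<in>J. ?b j)"
  proof (rule sum_emeasure)
    show "disjoint_family_on ?b J"
      unfolding disjoint_family_on_def
    proof (intro ballI impI)
      fix i j assume ij: "i \<in> J" "j \<in> J" "i \<noteq> j"
      show "?b i \<inter> ?b j = {}"
      proof (rule ccontr)
        assume "?b i \<inter> ?b j \<noteq> {}"
        then obtain x where x: "enorm d (x - p i) \<le> \<alpha> i" "enorm d (x - p j) \<le> \<alpha> j"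
          using bE ij by blast
        have "enorm d (p i - p j) = enorm d ((x - p j) + - (x - p i))" by (rule arg_cong) (simp add: fun_eq_iff)
        also have "\<dots> \<le> enorm d (x - p j) + enorm d (x - p i)"
          using enorm_triangle enorm_uminus by metis
        finally show False using x disj[OF ij] by simp
      qed
    qed
  qed (use \<open>finite J\<close> in \<open>auto simp: lognu_def\<close>)
  also have "\<dots> \<le> emeasure (lognu d) ?ann"
  proof (rule emeasure_mono)
    show "(\<Union>j\<in>J. ?b j) \<subseteq> ?ann"
    proof
      fix x assume "x \<in> (\<Union>j\<in>J. ?b j)"
      then obtain j where j: "j \<in> J" and x: "x \<in> space (leb d)" "enorm d (x - p j) \<le> \<alpha> j"
        using bE by blast
      have "enorm d x = enorm d ((x - p j) + p j)" "enorm d (p j) = enorm d (- (x - p j) + x)"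
        by (rule arg_cong, simp add: fun_eq_iff)+
      then have "enorm d x \<le> enorm d (x - p j) + enorm d (p j)" "enorm d (p j) \<le> enorm d (x - p j) + enorm d x"
        using enorm_triangle enorm_uminus by metis+
      then have "A \<le> enorm d x" "enorm d x \<le> B" using lo[OF j] hi[OF j] x by auto
      then show "x \<in> ?ann" using x by (simp add: enorm_sqn)
    qed
  qed (simp add: lognu_def)
  also have "\<dots> = ennreal (?w * ln (B / A))" by (rule emeasure_lognu_annulus[OF d AB])
  finally have "(\<Sum>j\<in>J. ?w * Phi d (\<alpha> j / enorm d (p j))) \<le> ?w * ln (B / A)"
    by (subst (asm) ennreal_le_iff) (use w AB in auto)
  then have le: "(\<Sum>j\<in>J. Phi d (\<alpha> j / enorm d (p j))) \<le> ln (B / A)"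
    by (simp only: sum_distrib_left[symmetric] mult_le_cancel_left_pos[OF w])
  have "(\<Sum>j\<in>J. ln (kappa d) + ln (2 * \<alpha> j / enorm d (p j))) \<le> (\<Sum>j\<in>J. Phi d (\<alpha> j / enorm d (p j)))"
  proof (rule sum_mono)
    fix j assume j: "j \<in> J"
    have "ln (kappa d) + ln (2 * (\<alpha> j / enorm d (p j))) \<le> Phi d (\<alpha> j / enorm d (p j))"
      using pos[OF j] half[OF j] by (intro Phi_lower d) (auto simp: field_simps)
    then show "ln (kappa d) + ln (2 * \<alpha> j / enorm d (p j)) \<le> Phi d (\<alpha> j / enorm d (p j))" by simp
  qed
  with le show ?thesis by simp
qed

text \<open>The set \<open>J\<close> in the proof consists of the stages at which the maximum increases; each increase is
  by a factor at most \<open>l + 1\<close>, so that a bound on \<open>card J\<close> bounds the sequence.\<close>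
lemma nearest_recursion_bounded:
  assumes d: "d \<ge> 1" and l: "1 \<le> l" "l < kappa d" and y0: "enorm d (y 0) = 0" and N: "N \<ge> 1" and c: "c \<ge> 0"
    and rec: "\<And>n j. n \<ge> N \<Longrightarrow> j < n \<Longrightarrow> enorm d (y (Suc n)) \<le> l * enorm d (y n - y j) + c"
  shows "\<exists>B. \<forall>n. enorm d (y n) \<le> B"
proof -
  define e where "e n = enorm d (y n)" for n
  define M where "M n = Max (e ` {..n})" for n
  have e_le_M: "e j \<le> M n" if "j \<le> n" for j n
    unfolding M_def using that by (intro Max_ge) auto
  have M_Suc: "M (Suc n) = max (e (Suc n)) (M n)" for n
    unfolding M_def by (simp add: atMost_Suc)
  have M_mono: "M n \<le> M m" if "n \<le> m" for n m
    using lift_Suc_mono_le[of M] that M_Suc by (metis max.cobounded2)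
  define eps where "eps = ln (kappa d) - ln l"
  have eps: "eps > 0" using l by (simp add: eps_def)
  obtain T where T: "T \<ge> 1" "T \<ge> 2 * c" "\<And>t. t \<ge> T \<Longrightarrow> ln (1 - c / t) \<ge> - eps / 2"
  proof -
    have "((\<lambda>t. ln (1 - c / t)) \<longlongrightarrow> ln (1 - 0)) at_top"
      by (intro tendsto_intros tendsto_divide_0[OF tendsto_const] filterlim_at_top_imp_at_infinity filterlim_ident) simp
    then have "\<forall>\<^sub>F t in at_top. - eps / 2 < ln (1 - c / t)"
      by (rule order_tendstoD) (use eps in simp)
    then obtain T0 where "\<And>t. t \<ge> T0 \<Longrightarrow> - eps / 2 < ln (1 - c / t)"
      by (auto simp: eventually_at_top_linorder)
    then show ?thesis by (intro that[of "max T0 (max 1 (2 * c))"]) (auto intro: less_imp_le)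
  qed
  show ?thesis
  proof (cases "\<exists>n0\<ge>N. M n0 \<ge> T")
    case False
    have "e n \<le> T" for n
      using e_le_M[of n "max n N"] False by (meson le_cases max.cobounded1 max.cobounded2 order_trans)
    then show ?thesis unfolding e_def by blast
  next
    case True
    then obtain n0 where n0: "n0 \<ge> N" "M n0 \<ge> T" by blast
    have MT: "M n \<ge> T" if "n \<ge> n0" for n using M_mono[OF that] n0 by simp
    define C where "C = M n0 * exp (2 * ln (6 * l) / eps * ln (l + 1))"
    have "M n1 \<le> C" if n1: "n1 \<ge> n0" for n1
    proof -
      define J where "J = {n \<in> {n0..<n1}. M n < e (Suc n)}"
      define \<alpha> where "\<alpha> n = (e (Suc n) - c) / (2 * l)" for n
      have fin: "finite J" by (simp add: J_def)
      have J: "n0 \<le> n" "n < n1" "M n < e (Suc n)" "M (Suc n) = e (Suc n)" "T \<le> M n" "T \<le> e (Suc n)" if "n \<in> J" for n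
        using that MT[of n] by (auto simp: J_def M_Suc)
      have \<alpha>_pos: "\<alpha> n > 0" if "n \<in> J" for n
        using J[OF that] T c l by (auto simp: \<alpha>_def)
      have dist: "2 * \<alpha> n \<le> enorm d (y n - y j)" if "n \<in> J" "j < n" for n j
        using rec[of n j] J[OF that(1)] n0 that l by (simp add: \<alpha>_def e_def field_simps)
      have half: "2 * \<alpha> n \<le> e n" if "n \<in> J" for n
      proof -
        have "2 * \<alpha> n \<le> enorm d (y n - y 0)" using dist[OF that, of 0] J[OF that] n0 N by simp
        also have "\<dots> \<le> enorm d (y n) + enorm d (- y 0)"
          using enorm_triangle[of d "y n" "- y 0"] by simp
        finally show ?thesis using y0 by (simp add: enorm_uminus e_def)
      qed
      have tele: "(\<Sum>n\<in>J. ln (M (Suc n)) - ln (M n)) = ln (M n1) - ln (M n0)"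
      proof -
        have "(\<Sum>n\<in>J. ln (M (Suc n)) - ln (M n)) = (\<Sum>n=n0..<n1. ln (M (Suc n)) - ln (M n))"
          by (rule sum.mono_neutral_left) (auto simp: J_def M_Suc max_def not_less)
        then show ?thesis using sum_Suc_diff'[OF n1, of "\<lambda>n. ln (M n)"] by simp
      qed
      define A where "A = M n0 / (4 * l)"
      define B where "B = 3 / 2 * M n1"
      have Mpos: "M n0 > 0" "M n1 > 0" using MT[of n0] MT[of n1] n1 T by auto
      have "(\<Sum>n\<in>J. ln (kappa d) + ln (2 * \<alpha> n / enorm d (y n))) \<le> ln (B / A)"
      proof (rule sum_ln_packing[OF d fin])
        show "0 < \<alpha> n" if "n \<in> J" for n by (rule \<alpha>_pos[OF that])
        show "2 * \<alpha> n \<le> enorm d (y n)" if "n \<in> J" for n using half[OF that] by (simp add: e_def)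
        have disj: "\<alpha> i + \<alpha> j < enorm d (y j - y i)" if "i \<in> J" "j \<in> J" "i < j" for i j
        proof -
          have "e (Suc i) \<le> M j" using that by (intro e_le_M) simp
          then have "\<alpha> i < \<alpha> j" using J[OF that(2)] l by (auto simp: \<alpha>_def divide_strict_right_mono)
          then show ?thesis using dist[OF that(2,3)] by simp
        qed
        show "\<alpha> i + \<alpha> j < enorm d (y i - y j)" if "i \<in> J" "j \<in> J" "i \<noteq> j" for i j
          using disj[of i j] disj[of j i] that enorm_minus_commute[of d "y i" "y j"] by (cases "i < j") auto
        show "0 < A" using Mpos l by (simp add: A_def)
        show "A \<le> B" 
        proof -
          have "A \<le> M n0 / 1" unfolding A_def using Mpos l by (intro divide_left_mono) auto
          then show ?thesis using M_mono[OF n1] Mpos by (simp add: B_def)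
        qed
        show "A \<le> enorm d (y n) - \<alpha> n" if "n \<in> J" for n
        proof -
          have "M n0 \<le> M n" using J[OF that] by (intro M_mono) simp
          then have "M n0 \<le> 2 * (e (Suc n) - c)" using J[OF that] T(2) MT[of n0] by auto
          then have "A \<le> \<alpha> n" unfolding A_def \<alpha>_def using l by (simp add: field_simps)
          then show ?thesis using half[OF that] by (simp add: e_def)
        qed
        show "enorm d (y n) + \<alpha> n \<le> B" if "n \<in> J" for n
          using half[OF that] e_le_M[of n n1] J[OF that] by (simp add: e_def B_def)
      qed
      moreover have "(\<Sum>n\<in>J. eps / 2 + (ln (M (Suc n)) - ln (M n)))
          \<le> (\<Sum>n\<in>J. ln (kappa d) + ln (2 * \<alpha> n / enorm d (y n)))"
      proof (rule sum_mono)
        fix n assume n: "n \<in> J"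
        have en: "e n > 0" using half[OF n] \<alpha>_pos[OF n] by simp
        have pos: "e (Suc n) > 0" "M n > 0" "e (Suc n) - c > 0" using J[OF n] T c by auto
        have "2 * \<alpha> n = (e (Suc n) - c) / l" using l by (simp add: \<alpha>_def field_simps)
        then have "ln (2 * \<alpha> n / e n) = ln (e (Suc n) - c) - ln l - ln (e n)"
          using pos en l by (simp add: ln_div ln_mult)
        moreover have "ln (e (Suc n) - c) = ln (e (Suc n)) + ln (1 - c / e (Suc n))"
        proof -
          have "e (Suc n) - c = e (Suc n) * (1 - c / e (Suc n))" "1 - c / e (Suc n) > 0"
            using pos by (simp_all add: field_simps)
          then show ?thesis using pos by (simp add: ln_mult)
        qed
        moreover have "ln (e n) \<le> ln (M n)" using e_le_M[of n n] en by simp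
        ultimately have "ln (2 * \<alpha> n / e n) \<ge> ln (M (Suc n)) + ln (1 - c / e (Suc n)) - ln l - ln (M n)"
          using J(4)[OF n] by simp
        then have "eps / 2 + (ln (M (Suc n)) - ln (M n)) \<le> ln (kappa d) + ln (2 * \<alpha> n / e n)"
          using T(3)[OF J(6)[OF n]] eps_def by argo
        then show "eps / 2 + (ln (M (Suc n)) - ln (M n)) \<le> ln (kappa d) + ln (2 * \<alpha> n / enorm d (y n))"
          by (simp only: e_def)
      qed
      moreover have "ln (B / A) = ln (6 * l) + (ln (M n1) - ln (M n0))"
      proof -
        have "B / A = 6 * l * (M n1 / M n0)" using Mpos l by (simp add: A_def B_def field_simps)
        then show ?thesis using Mpos l by (simp add: ln_mult ln_div)
      qed
      ultimately have "card J * (eps / 2) \<le> ln (6 * l)"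
        by (simp add: sum.distrib tele)
      then have cJ: "card J \<le> 2 * ln (6 * l) / eps" using eps by (simp add: field_simps)
      have "(\<Sum>n\<in>J. ln (M (Suc n)) - ln (M n)) \<le> (\<Sum>n\<in>J. ln (l + 1))"
      proof (rule sum_mono)
        fix n assume n: "n \<in> J"
        have "e (Suc n) \<le> l * enorm d (y n - y 0) + c"
          using rec[of n 0] J[OF n] n0 N by (simp add: e_def)
        moreover have "enorm d (y n - y 0) \<le> M n"
          using enorm_triangle[of d "y n" "- y 0"] y0 e_le_M[of n n] by (simp add: enorm_uminus e_def)
        ultimately have "e (Suc n) \<le> l * M n + c"
          using l mult_left_mono[of "enorm d (y n - y 0)" "M n" l] by linarith
        also have "\<dots> \<le> (l + 1) * M n" using J[OF n] T c by (simp add: algebra_simps)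
        finally have "M (Suc n) \<le> (l + 1) * M n" using J(4)[OF n] by simp
        moreover have "M n > 0" "M (Suc n) > 0" using J[OF n] T by auto
        ultimately have "ln (M (Suc n)) \<le> ln ((l + 1) * M n)" using l by simp
        then show "ln (M (Suc n)) - ln (M n) \<le> ln (l + 1)"
          using \<open>M n > 0\<close> l by (simp add: ln_mult)
      qed
      then have "ln (M n1) - ln (M n0) \<le> card J * ln (l + 1)" by (simp add: tele)
      also have "\<dots> \<le> 2 * ln (6 * l) / eps * ln (l + 1)" using cJ l by (intro mult_right_mono) auto
      finally have "ln (M n1) \<le> ln C" using Mpos by (simp add: C_def ln_mult)
      then show ?thesis using Mpos by (simp add: C_def)
    qed
    then have "e n \<le> C" for n
      using e_le_M[of n "max n n0"] by (meson max.cobounded1 max.cobounded2 order_trans)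
    then show ?thesis unfolding e_def by blast
  qed
qed

lemma Rd_add: "x \<in> Rd d \<Longrightarrow> y \<in> Rd d \<Longrightarrow> x + y \<in> Rd d"
  and Rd_diff: "x \<in> Rd d \<Longrightarrow> y \<in> Rd d \<Longrightarrow> x - y \<in> Rd d"
  and Rd_zero: "0 \<in> Rd d"
  by (auto simp: Rd_def)

lemma Env_eq:
  "rs \<noteq> [] \<Longrightarrow> Env d l (xs, rs) = Max {max (enorm d (rs ! i - rs ! j) - l * enorm d (xs ! i - xs ! j)) 0
               | i j. i < length rs \<and> j < length rs}"
  unfolding Env_def prod.case by (rule if_not_P)

lemma Env_Nil: "Env d l (xs, []) = 0"
  unfolding Env_def prod.case by (rule if_P[OF refl])

lemma Env_ge:
  assumes "i < length rs" "j < length rs"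
  shows "enorm d (rs ! i - rs ! j) - l * enorm d (xs ! i - xs ! j) \<le> Env d l (xs, rs)"
proof -
  have "rs \<noteq> []" using assms by auto
  have "max (enorm d (rs ! i - rs ! j) - l * enorm d (xs ! i - xs ! j)) 0 \<le> Env d l (xs, rs)"
    unfolding Env_eq[OF \<open>rs \<noteq> []\<close>] using assms by (intro Max_ge finite_image_set2 finite_Collect_less_nat) blast
  then show ?thesis by simp
qed

lemma Env_le:
  assumes "0 \<le> b" "\<And>i j. i < length rs \<Longrightarrow> j < length rs \<Longrightarrow>
    enorm d (rs ! i - rs ! j) - l * enorm d (xs ! i - xs ! j) \<le> b"
  shows "Env d l (xs, rs) \<le> b"
proof (cases "rs = []")
  case True
  then show ?thesis using assms by (simp add: Env_Nil)
next
  case False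
  show ?thesis
    unfolding Env_eq[OF False] 
  proof (rule Max.boundedI)
    show "finite {max (enorm d (rs ! i - rs ! j) - l * enorm d (xs ! i - xs ! j)) 0 | i j. i < length rs \<and> j < length rs}"
      by (intro finite_image_set2 finite_Collect_less_nat)
    show "{max (enorm d (rs ! i - rs ! j) - l * enorm d (xs ! i - xs ! j)) 0 | i j. i < length rs \<and> j < length rs} \<noteq> {}"
      using False by blast
  qed (use assms in auto)
qed

lemma Env_nonneg: "0 \<le> Env d l H"
proof (cases H)
  case (Pair xs rs)
  have "0 \<le> Env d l (xs, rs)" if "rs \<noteq> []"
    using Env_ge[of 0 rs 0 d l xs] that by (simp add: enorm_sqn sqn_def)
  then show ?thesis using Pair by (cases "rs = []") (simp_all add: Env_Nil)
qed

lemma rad_ge: "i \<le> length rs \<Longrightarrow> enorm d (xs ! i - xs ! 0) \<le> rad d (xs, rs)"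
  unfolding rad_def prod.case by (intro Max_ge finite_image_set finite_Collect_le_nat) blast

lemma rad_le: "(\<And>i. i \<le> length rs \<Longrightarrow> enorm d (xs ! i - xs ! 0) \<le> b) \<Longrightarrow> rad d (xs, rs) \<le> b"
  unfolding rad_def prod.case by (intro Max.boundedI finite_image_set finite_Collect_le_nat) blast+

definition nearest_controller :: "nat \<Rightarrow> history \<Rightarrow> vec" where
  "nearest_controller d = (\<lambda>(xs, rs). if rs = [] then 0
     else xs ! 0 - rs ! arg_min_on (\<lambda>i. enorm d (xs ! length rs - xs ! i)) {..<length rs})"

lemma nearest_controller_strategy: "nearest_controller d \<in> controller_strategies d"
proof -
  have "nearest_controller d (xs, rs) \<in> Rd d" if "(xs, rs) \<in> histories d" for xs rs
  proof (cases "rs = []")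
    case False
    let ?i = "arg_min_on (\<lambda>i. enorm d (xs ! length rs - xs ! i)) {..<length rs}"
    have "?i < length rs" using False arg_min_if_finite(1)[of "{..<length rs}"] by auto
    moreover have "0 < length xs" using that by (simp add: histories_def)
    ultimately have "xs ! 0 \<in> Rd d" "rs ! ?i \<in> Rd d"
      using that nth_mem unfolding histories_def by blast+
    then show ?thesis using False by (simp add: nearest_controller_def Rd_diff)
  qed (simp add: nearest_controller_def Rd_zero)
  then show ?thesis by (auto simp: controller_strategies_def)
qed

lemma state_seq_lengths:
  assumes "length (fst H0) = Suc (length (snd H0))"
  shows "length (snd (state_seq \<mu> \<sigma> H0 k)) = length (snd H0) + k
    \<and> length (fst (state_seq \<mu> \<sigma> H0 k)) = Suc (length (snd H0) + k)"
  by (induction k) (auto simp: assms succ_hist_def Let_def case_prod_beta)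

lemma state_seq_nth:
  assumes len: "length (fst H0) = Suc (length (snd H0))" and "k \<le> m"
  shows "i \<le> length (snd H0) + k \<Longrightarrow> fst (state_seq \<mu> \<sigma> H0 m) ! i = fst (state_seq \<mu> \<sigma> H0 k) ! i"
    and "i < length (snd H0) + k \<Longrightarrow> snd (state_seq \<mu> \<sigma> H0 m) ! i = snd (state_seq \<mu> \<sigma> H0 k) ! i"
  using \<open>k \<le> m\<close>
proof (induction m rule: dec_induct)
  case (step m)
  { case 1 then show ?case using step state_seq_lengths[OF len, of \<mu> \<sigma> m]
      by (auto simp: succ_hist_def Let_def case_prod_beta nth_append) }
  { case 2 then show ?case using step state_seq_lengths[OF len, of \<mu> \<sigma> m]
      by (auto simp: succ_hist_def Let_def case_prod_beta nth_append) }
qed auto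

lemma no_winning_history:
  assumes d: "d \<ge> 1" and l: "1 \<le> l" "l < kappa d"
  shows "winning_histories d l = {}"
proof (rule ccontr)
  assume "winning_histories d l \<noteq> {}"
  then obtain H0 \<sigma> where H0: "H0 \<in> histories d"
    and \<sigma>: "\<And>\<mu>. \<mu> \<in> controller_strategies d \<Longrightarrow> resulting_play \<mu> \<sigma> H0 \<in> Esc d l H0"
    by (auto simp: winning_histories_def adversary_wins_def)
  define n0 where "n0 = length (snd H0)"
  have len0: "length (fst H0) = Suc (length (snd H0))" using H0 by (auto simp: histories_def)
  define \<mu> where "\<mu> = nearest_controller d"
  define H where "H k = state_seq \<mu> \<sigma> H0 k" for k
  have len: "length (snd (H k)) = n0 + k" "length (fst (H k)) = Suc (n0 + k)" for k
    using state_seq_lengths[OF len0] by (auto simp: H_def n0_def)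
  have "resulting_play \<mu> \<sigma> H0 \<in> Esc d l H0"
    using \<sigma> nearest_controller_strategy by (simp add: \<mu>_def)
  moreover have "hist_at (resulting_play \<mu> \<sigma> H0) k = H k" for k
    by (simp add: hist_at_def resulting_play_def H_def Let_def)
  ultimately have env: "(SUP k. ereal (Env d l (H k))) < \<infinity>" and rad: "(SUP k. ereal (rad d (H k))) = \<infinity>"
    by (auto simp: Esc_def Env_inf_def)
  obtain c where c: "c \<ge> 0" "\<And>k. Env d l (H k) \<le> c"
  proof -
    let ?S = "SUP k. ereal (Env d l (H k))"
    have le: "ereal (Env d l (H k)) \<le> ?S" for k by (rule SUP_upper) simp
    then obtain c where S: "?S = ereal c" using env by (cases ?S) (auto dest: spec[of _ 0])
    then have E: "Env d l (H k) \<le> c" for k using le[of k] by simp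
    moreover have "c \<ge> 0" using E[of 0] Env_nonneg[of d l "H 0"] by simp
    ultimately show ?thesis using that by blast
  qed
  define X where "X n = fst (H n) ! n" for n
  define R where "R n = snd (H (Suc n)) ! n" for n
  have X: "fst (H k) ! i = X i" if "i \<le> n0 + k" for i k
    using state_seq_nth(1)[OF len0, of k "max k i" i \<mu> \<sigma>] state_seq_nth(1)[OF len0, of i "max k i" i \<mu> \<sigma>] that
    by (simp add: X_def H_def n0_def)
  have R: "snd (H k) ! i = R i" if "i < n0 + k" for i k
    using state_seq_nth(2)[OF len0, of k "max k (Suc i)" i \<mu> \<sigma>]
      state_seq_nth(2)[OF len0, of "Suc i" "max k (Suc i)" i \<mu> \<sigma>] that
    by (simp add: R_def H_def n0_def)
  define y where "y n = X n - X 0" for n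
  have "\<exists>B. \<forall>n. enorm d (y n) \<le> B"
  proof (rule nearest_recursion_bounded[OF d l, where N = "Suc n0" and c = c])
    show "enorm d (y 0) = 0" by (simp add: y_def enorm_sqn sqn_def)
    show "c \<ge> 0" by fact
    fix n j assume n: "Suc n0 \<le> n" and j: "j < n"
    define k where "k = n - n0"
    have nk: "n = n0 + k" using n by (simp add: k_def)
    let ?f = "\<lambda>i. enorm d (fst (H k) ! n - fst (H k) ! i)"
    define i where "i = arg_min_on ?f {..<n}"
    have i: "i < n" "?f i \<le> ?f j"
      using arg_min_if_finite(1)[of "{..<n}" ?f] arg_min_least[of "{..<n}" j ?f] j
      by (auto simp: i_def)
    have u: "\<mu> (H k) = X 0 - R i"
    proof -
      have "\<mu> (H k) = fst (H k) ! 0 - snd (H k) ! i"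
        using len[of k] nk j unfolding \<mu>_def nearest_controller_def case_prod_beta i_def by auto
      then show ?thesis using X[of 0 k] R[of i k] i nk by simp
    qed
    define r where "r = \<sigma> (H k, \<mu> (H k))"
    have HS: "H (Suc k) = (fst (H k) @ [\<mu> (H k) + r], snd (H k) @ [r])"
      by (simp add: H_def Let_def succ_hist_def case_prod_beta r_def)
    have r: "r = R n" using R[of n "Suc k"] nk len[of k] HS by (simp add: nth_append)
    have "X (Suc n) = \<mu> (H k) + r" using X[of "Suc n" "Suc k"] nk len[of k] HS by (simp add: nth_append)
    then have "y (Suc n) = R n - R i" unfolding y_def u r by (simp add: fun_eq_iff)
    moreover have "enorm d (R n - R i) - l * enorm d (X n - X i) \<le> c"
    proof -
      have "enorm d (snd (H (Suc k)) ! n - snd (H (Suc k)) ! i) - l * enorm d (fst (H (Suc k)) ! n - fst (H (Suc k)) ! i)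
          \<le> Env d l (fst (H (Suc k)), snd (H (Suc k)))"
        by (rule Env_ge) (use len[of "Suc k"] nk i in auto)
      then show ?thesis using X[of n "Suc k"] X[of i "Suc k"] R[of n "Suc k"] R[of i "Suc k"] nk i c(2)[of "Suc k"]
        by simp
    qed
    moreover have "l * enorm d (X n - X i) \<le> l * enorm d (y n - y j)"
    proof (rule mult_left_mono)
      have "X n - X j = y n - y j" by (simp add: y_def fun_eq_iff)
      then show "enorm d (X n - X i) \<le> enorm d (y n - y j)"
        using i X[of n k] X[of i k] X[of j k] nk j by simp
    qed (use l in simp)
    ultimately show "enorm d (y (Suc n)) \<le> l * enorm d (y n - y j) + c" by simp
  qed simp
  then obtain B where B: "\<And>n. enorm d (y n) \<le> B" by blast
  have "rad d (H k) \<le> B" for k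
  proof -
    have "rad d (fst (H k), snd (H k)) \<le> B"
      by (rule rad_le) (use B X[of _ k] len[of k] in \<open>auto simp: y_def\<close>)
    then show ?thesis by simp
  qed
  then have "(SUP k. ereal (rad d (H k))) \<le> ereal B" by (intro SUP_least) simp
  then show False using rad by simp
qed

lemma kappa_le_game_value:
  assumes d: "d \<ge> 1"
  shows "ereal (kappa d) \<le> game_value d"
proof (rule ccontr)
  assume "\<not> ?thesis"
  then have less: "game_value d < ereal (kappa d)" by simp
  have mem: "ereal l \<le> game_value d" if "1 \<le> l" "l < kappa d" for l
  proof -
    have "\<exists>l'. ereal l = ereal l' \<and> 0 \<le> l' \<and> winning_histories d l' = {}"
      using no_winning_history[OF d that] that by (intro exI[of _ l]) simp
    then have "ereal l \<in> {0} \<union> {ereal l' | l'. 0 \<le> l' \<and> winning_histories d l' = {}}"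
      unfolding Un_iff mem_Collect_eq by (rule disjI2)
    then show ?thesis unfolding game_value_def by (rule Sup_upper)
  qed
  have "1 / (real d * 2 ^ d) > 0" using d by simp
  then have k1: "1 < kappa d" using kappa_gt[OF d] by linarith
  have "ereal 1 \<le> game_value d" by (rule mem[OF order_refl k1])
  with less obtain v where v: "game_value d = ereal v" "1 \<le> v" "v < kappa d"
    by (cases "game_value d") auto
  have "ereal ((v + kappa d) / 2) \<le> ereal v"
    unfolding v(1)[symmetric] by (rule mem) (use v in simp_all)
  then show False using v by simp
qed

definition proj :: "nat \<Rightarrow> vec \<Rightarrow> vec" where
  "proj d x = (\<lambda>i. if i < d then x i else 0)"

definition proj_hist :: "nat \<Rightarrow> history \<Rightarrow> history" where
  "proj_hist d H = (map (proj d) (fst H), map (proj d) (snd H))"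

lemma proj_Rd: "proj d x \<in> Rd d"
  by (simp add: proj_def Rd_def)

lemma proj_id: "x \<in> Rd d \<Longrightarrow> proj d x = x"
  by (auto simp: proj_def Rd_def fun_eq_iff)

lemma proj_add: "proj d (x + y) = proj d x + proj d y"
  by (auto simp: proj_def fun_eq_iff)

lemma enorm_proj_diff: "enorm d (proj d x - proj d y) = enorm d (x - y)"
  by (simp add: enorm_sqn sqn_def proj_def)

lemma enorm_Suc_ge: "enorm d x \<le> enorm (Suc d) x"
  by (simp add: enorm_sqn sqn_def)

lemma enorm_Suc_eq:
  assumes "x \<in> Rd d" "y \<in> Rd d"
  shows "enorm (Suc d) (x - y) = enorm d (x - y)"
  using assms by (simp add: enorm_sqn sqn_def Rd_def)

lemma Rd_mono: "Rd d \<subseteq> Rd (Suc d)"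
  by (auto simp: Rd_def)

lemma proj_hist_histories:
  assumes "H \<in> histories e"
  shows "proj_hist d H \<in> histories d"
  using assms proj_Rd by (auto simp: histories_def proj_hist_def)

lemma proj_hist_id:
  assumes "H \<in> histories d"
  shows "proj_hist d H = H"
  using assms by (auto simp: histories_def proj_hist_def intro!: map_idI proj_id)

lemma succ_hist_histories:
  assumes "H \<in> histories d" "u \<in> Rd d" "r \<in> Rd d"
  shows "succ_hist H u r \<in> histories d"
  using assms Rd_add by (auto simp: histories_def succ_hist_def)

lemma proj_succ_hist:
  assumes "r \<in> Rd d"
  shows "proj_hist d (succ_hist H u r) = succ_hist (proj_hist d H) (proj d u) r"
  using assms by (simp add: proj_hist_def succ_hist_def case_prod_beta proj_add proj_id)

lemma Env_Suc_le:
  assumes l: "l \<ge> 0" and H: "H \<in> histories (Suc d)" "set (snd H) \<subseteq> Rd d"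
  shows "Env (Suc d) l H \<le> Env d l (proj_hist d H)"
proof -
  obtain xs rs where HE: "H = (xs, rs)" by (cases H)
  have len: "length xs = Suc (length rs)" using H HE by (simp add: histories_def)
  have "Env (Suc d) l (xs, rs) \<le> Env d l (map (proj d) xs, map (proj d) rs)"
  proof (rule Env_le[OF Env_nonneg])
    fix i j assume ij: "i < length rs" "j < length rs"
    then have r: "rs ! i \<in> Rd d" "rs ! j \<in> Rd d" using H(2) HE nth_mem by auto
    have "enorm (Suc d) (rs ! i - rs ! j) - l * enorm (Suc d) (xs ! i - xs ! j)
      \<le> enorm d (rs ! i - rs ! j) - l * enorm d (xs ! i - xs ! j)"
      using l by (simp add: enorm_Suc_eq[OF r] mult_left_mono enorm_Suc_ge)
    also have "\<dots> = enorm d (map (proj d) rs ! i - map (proj d) rs ! j)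
        - l * enorm d (map (proj d) xs ! i - map (proj d) xs ! j)"
      using ij len by (simp add: enorm_proj_diff)
    also have "\<dots> \<le> Env d l (map (proj d) xs, map (proj d) rs)"
      by (rule Env_ge) (use ij in simp_all)
    finally show "enorm (Suc d) (rs ! i - rs ! j) - l * enorm (Suc d) (xs ! i - xs ! j)
      \<le> Env d l (map (proj d) xs, map (proj d) rs)" .
  qed
  then show ?thesis by (simp add: HE proj_hist_def)
qed

lemma rad_Suc_ge:
  assumes H: "H \<in> histories (Suc d)"
  shows "rad d (proj_hist d H) \<le> rad (Suc d) H"
proof -
  obtain xs rs where HE: "H = (xs, rs)" by (cases H)
  have len: "length xs = Suc (length rs)" using H HE by (simp add: histories_def)
  have "rad d (map (proj d) xs, map (proj d) rs) \<le> rad (Suc d) (xs, rs)"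
  proof (rule rad_le)
    fix i assume i: "i \<le> length (map (proj d) rs)"
    have "0 < length xs" using len by simp
    then have "enorm d (map (proj d) xs ! i - map (proj d) xs ! 0) = enorm d (xs ! i - xs ! 0)"
      using i len by (simp add: enorm_proj_diff)
    also have "\<dots> \<le> enorm (Suc d) (xs ! i - xs ! 0)" by (rule enorm_Suc_ge)
    also have "\<dots> \<le> rad (Suc d) (xs, rs)" by (rule rad_ge) (use i in simp)
    finally show "enorm d (map (proj d) xs ! i - map (proj d) xs ! 0) \<le> rad (Suc d) (xs, rs)" .
  qed
  then show ?thesis by (simp add: HE proj_hist_def)
qed

text \<open>In dimension \<open>d + 1\<close> the adversary answers the projected play; the projected controller
  moves depend on the stage only, and so are produced by a controller strategy in dimension \<open>d\<close>.\<close>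
lemma winning_histories_Suc:
  assumes l: "l \<ge> 0" and H0: "H0 \<in> winning_histories d l"
  shows "H0 \<in> winning_histories (Suc d) l"
proof -
  have H0d: "H0 \<in> histories d" using H0 by (simp add: winning_histories_def)
  then have H0s: "H0 \<in> histories (Suc d)" using Rd_mono by (fastforce simp: histories_def)
  have len0: "length (fst H0) = Suc (length (snd H0))" using H0d by (auto simp: histories_def)
  obtain \<sigma> where \<sigma>: "\<sigma> \<in> adversary_strategies d"
    and win: "\<And>\<mu>. \<mu> \<in> controller_strategies d \<Longrightarrow> resulting_play \<mu> \<sigma> H0 \<in> Esc d l H0"
    using H0 by (auto simp: winning_histories_def adversary_wins_def)
  define \<sigma>' where "\<sigma>' = (\<lambda>(H, u). \<sigma> (proj_hist d H, proj d u))"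
  have \<sigma>'_Rd: "\<sigma>' (H, u) \<in> Rd d" if "H \<in> histories (Suc d)" for H u
    using \<sigma> proj_hist_histories[OF that, of d] proj_Rd[of d u] by (simp add: \<sigma>'_def adversary_strategies_def)
  have \<sigma>': "\<sigma>' \<in> adversary_strategies (Suc d)"
    unfolding adversary_strategies_def using \<sigma>'_Rd Rd_mono by blast
  have "resulting_play \<mu>' \<sigma>' H0 \<in> Esc (Suc d) l H0" if \<mu>': "\<mu>' \<in> controller_strategies (Suc d)" for \<mu>'
  proof -
    define K where "K k = state_seq \<mu>' \<sigma>' H0 k" for k
    have K_Suc: "K (Suc k) = succ_hist (K k) (\<mu>' (K k)) (\<sigma>' (K k, \<mu>' (K k)))" for k
      by (simp add: K_def Let_def)
    have K: "K k \<in> histories (Suc d) \<and> set (snd (K k)) \<subseteq> Rd d" for k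
    proof (induction k)
      case 0
      then show ?case using H0s H0d by (auto simp: K_def histories_def)
    next
      case (Suc k)
      have r: "\<sigma>' (K k, \<mu>' (K k)) \<in> Rd d" using \<sigma>'_Rd Suc by blast
      have "\<mu>' (K k) \<in> Rd (Suc d)" using \<mu>' Suc by (simp add: controller_strategies_def)
      then have "K (Suc k) \<in> histories (Suc d)"
        unfolding K_Suc using r Rd_mono Suc by (intro succ_hist_histories) auto
      moreover have "snd (K (Suc k)) = snd (K k) @ [\<sigma>' (K k, \<mu>' (K k))]"
        by (simp add: K_Suc succ_hist_def case_prod_beta)
      ultimately show ?case using r Suc by simp
    qed
    define \<mu> where "\<mu> H = proj d (\<mu>' (K (length (snd H) - length (snd H0))))" for H :: history
    have "\<mu> \<in> controller_strategies d" by (simp add: controller_strategies_def \<mu>_def proj_Rd)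
    then have esc: "resulting_play \<mu> \<sigma> H0 \<in> Esc d l H0" by (rule win)
    have S: "state_seq \<mu> \<sigma> H0 k = proj_hist d (K k)" for k
    proof (induction k)
      case 0
      show ?case by (simp add: K_def proj_hist_id[OF H0d])
    next
      case (Suc k)
      have "length (snd (K k)) = length (snd H0) + k"
        using state_seq_lengths[OF len0] by (simp add: K_def)
      then have \<mu>: "\<mu> (proj_hist d (K k)) = proj d (\<mu>' (K k))"
        by (simp add: \<mu>_def proj_hist_def)
      have r: "\<sigma>' (K k, \<mu>' (K k)) \<in> Rd d" using \<sigma>'_Rd K by blast
      show ?case
        unfolding K_Suc proj_succ_hist[OF r] by (simp add: Suc \<mu> Let_def \<sigma>'_def)
    qed
    have hist: "hist_at (resulting_play \<mu> \<sigma> H0) k = proj_hist d (K k)"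
      "hist_at (resulting_play \<mu>' \<sigma>' H0) k = K k" for k
      by (simp_all add: hist_at_def resulting_play_def S Let_def K_def)
    have env: "(SUP k. ereal (Env d l (proj_hist d (K k)))) < \<infinity>"
      and rad: "(SUP k. ereal (rad d (proj_hist d (K k)))) = \<infinity>"
      using esc by (auto simp: Esc_def Env_inf_def hist)
    have "(SUP k. ereal (Env (Suc d) l (K k))) \<le> (SUP k. ereal (Env d l (proj_hist d (K k))))"
    proof (rule SUP_mono)
      fix k
      show "\<exists>m\<in>UNIV. ereal (Env (Suc d) l (K k)) \<le> ereal (Env d l (proj_hist d (K m)))"
        using Env_Suc_le[OF l, of "K k" d] K[of k] by (intro bexI[of _ k]) simp_all
    qed
    then have 1: "(SUP k. ereal (Env (Suc d) l (K k))) < \<infinity>" using env by (rule le_less_trans)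
    have "(SUP k. ereal (rad d (proj_hist d (K k)))) \<le> (SUP k. ereal (rad (Suc d) (K k)))"
    proof (rule SUP_mono)
      fix k
      show "\<exists>m\<in>UNIV. ereal (rad d (proj_hist d (K k))) \<le> ereal (rad (Suc d) (K m))"
        using rad_Suc_ge[of "K k" d] K[of k] by (intro bexI[of _ k]) simp_all
    qed
    then have 2: "(SUP k. ereal (rad (Suc d) (K k))) = \<infinity>" using rad by simp
    have 3: "resulting_play \<mu>' \<sigma>' H0 \<in> plays (Suc d) H0"
      unfolding plays_def mem_Collect_eq hist
    proof (intro conjI allI)
      show "K 0 = H0" by (simp add: K_def)
      fix k
      have "\<mu>' (K k) \<in> Rd (Suc d)" using \<mu>' K by (simp add: controller_strategies_def)
      moreover have "\<sigma>' (K k, \<mu>' (K k)) \<in> Rd (Suc d)" using \<sigma>'_Rd K Rd_mono by blast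
      moreover have "resulting_play \<mu>' \<sigma>' H0 k = (K k, \<mu>' (K k), \<sigma>' (K k, \<mu>' (K k)), K (Suc k))"
        by (simp add: resulting_play_def K_def Let_def)
      ultimately show "\<exists>u\<in>Rd (Suc d). \<exists>r\<in>Rd (Suc d). resulting_play \<mu>' \<sigma>' H0 k = (K k, u, r, K (Suc k)) \<and>
          K (Suc k) = succ_hist (K k) u r"
        using K_Suc by blast
    qed
    show ?thesis using 1 2 3 by (simp add: Esc_def Env_inf_def hist)
  qed
  then show ?thesis using H0s \<sigma>' by (auto simp: winning_histories_def adversary_wins_def)
qed

lemma game_value_Suc_le: "game_value (Suc d) \<le> game_value d"
  unfolding game_value_def using winning_histories_Suc by (intro Sup_subset_mono) blast

theorem theorem3p9:
  fixes d :: nat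
  assumes "d \<ge> 1"
  shows "game_value d \<ge> ereal (kappa d)
    \<and> kappa d > 1 + 1 / (real d * 2 ^ d)
    \<and> 1 + 1 / (real d * 2 ^ d) > 1
    \<and> game_value (d + 1) \<le> game_value d"
proof (intro conjI)
  show "1 + 1 / (real d * 2 ^ d) > 1" using assms by simp
  show "game_value (d + 1) \<le> game_value d" using game_value_Suc_le[of d] by simp
qed (use assms in \<open>rule kappa_le_game_value kappa_gt; simp\<close>)+


end
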